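(* The following statements hold for every integer $k>1$: (i) Every graph of connected tree-width $k$ is $k$-hyperbolic. (ii) There exists a graph of connected tree-width $k$ that is not $(k-1)$-hyperbolic. Moreover, the graphs of connected tree-width $1$ are forests, which are $0$-hyperbolic.
   Context: Graphs are simple and undirected. A tree-decomposition of a graph $G=(V,E)$ is a pair $(T,(V_t)_{t\in T})$ of a tree $T$ and a family of vertex sets $V_t\subseteq V$ (its parts), indexed by the nodes of $T$, such that (T1) $V=\bigcup_t V_t$; (T2) for every edge of $G$ some $V_t$ contains both its ends; (T3) $V_{t_1}\cap V_{t_3}\subseteq V_{t_2}$ whenever $t_2$ lies on the path between $t_1$ and $t_3$ in $T$. Its width is $\max_t|V_t|-1$. A tree-decomposition is connected if each of its parts induces a connected subgraph of $G$. The connected tree-width of $G$ is the minimum width of a connected tree-decomposition of $G$. Given a real number $d\ge0$, a graph $G$ is $d$-hyperbolic if whenever vertices $x,y,z$ are linked by shortest paths $P_{xy}=x\dots y$, $P_{yz}=y\dots z$ and $P_{xz}=x\dots z$ in $G$, each of these paths lies within distance $d$ of the other two, i.e. every vertex of each of the three paths has distance (in $G$) at most $d$ from some vertex of the union of the other two paths. *)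

theory Defs
  imports Main "HOL-Library.Extended_Nat" "HOL-Library.Extended_Real"
begin

text \<open>Simple undirected graphs, possibly infinite; an edge is a set of two vertices.\<close>

record 'a graph =
  verts :: "'a set"
  edges :: "'a set set"

definition simple_graph :: "'a graph \<Rightarrow> bool" where
  "simple_graph G \<longleftrightarrow>
     (\<forall>e\<in>edges G. \<exists>u v. u \<in> verts G \<and> v \<in> verts G \<and> u \<noteq> v \<and> e = {u, v})"

definition induced_subgraph :: "'a graph \<Rightarrow> 'a set \<Rightarrow> 'a graph" where
  "induced_subgraph G U = \<lparr>verts = verts G \<inter> U, edges = {e \<in> edges G. e \<subseteq> U}\<rparr>"

text \<open>A path is the list of its vertices; its length is the number of its edges,
  that is, one less than the length of the list.\<close>

definition is_path :: "'a graph \<Rightarrow> 'a list \<Rightarrow> bool" where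
  "is_path G p \<longleftrightarrow> p \<noteq> [] \<and> distinct p \<and> set p \<subseteq> verts G \<and>
     successively (\<lambda>u v. {u, v} \<in> edges G) p"

definition path_between :: "'a graph \<Rightarrow> 'a \<Rightarrow> 'a list \<Rightarrow> 'a \<Rightarrow> bool" where
  "path_between G x p y \<longleftrightarrow> is_path G p \<and> hd p = x \<and> last p = y"

definition path_length :: "'a list \<Rightarrow> nat" where
  "path_length p = length p - 1"

definition shortest_path :: "'a graph \<Rightarrow> 'a \<Rightarrow> 'a list \<Rightarrow> 'a \<Rightarrow> bool" where
  "shortest_path G x p y \<longleftrightarrow> path_between G x p y \<and>
     (\<forall>q. path_between G x q y \<longrightarrow> path_length p \<le> path_length q)"

text \<open>The distance is infinite if there is no path.\<close>

definition gdist :: "'a graph \<Rightarrow> 'a \<Rightarrow> 'a \<Rightarrow> enat" where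
  "gdist G x y = (INF p\<in>{p. path_between G x p y}. enat (path_length p))"

definition connected_graph :: "'a graph \<Rightarrow> bool" where
  "connected_graph G \<longleftrightarrow> verts G \<noteq> {} \<and>
     (\<forall>x\<in>verts G. \<forall>y\<in>verts G. \<exists>p. path_between G x p y)"

definition is_cycle :: "'a graph \<Rightarrow> 'a list \<Rightarrow> bool" where
  "is_cycle G c \<longleftrightarrow> length c \<ge> 3 \<and> is_path G c \<and> {last c, hd c} \<in> edges G"

definition forest :: "'a graph \<Rightarrow> bool" where
  "forest G \<longleftrightarrow> simple_graph G \<and> (\<nexists>c. is_cycle G c)"

definition tree :: "'a graph \<Rightarrow> bool" where
  "tree G \<longleftrightarrow> forest G \<and> connected_graph G"

definition tree_decomposition :: "'a graph \<Rightarrow> 'n graph \<Rightarrow> ('n \<Rightarrow> 'a set) \<Rightarrow> bool" where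
  "tree_decomposition G T V \<longleftrightarrow> tree T \<and>
     (\<forall>t\<in>verts T. V t \<subseteq> verts G) \<and>
     verts G = (\<Union>t\<in>verts T. V t) \<and>
     (\<forall>e\<in>edges G. \<exists>t\<in>verts T. e \<subseteq> V t) \<and>
     (\<forall>t1 t2 t3 p. path_between T t1 p t3 \<and> t2 \<in> set p \<longrightarrow> V t1 \<inter> V t3 \<subseteq> V t2)"

definition connected_tree_decomposition ::
    "'a graph \<Rightarrow> 'n graph \<Rightarrow> ('n \<Rightarrow> 'a set) \<Rightarrow> bool" where
  "connected_tree_decomposition G T V \<longleftrightarrow> tree_decomposition G T V \<and>
     (\<forall>t\<in>verts T. connected_graph (induced_subgraph G (V t)))"

definition esize :: "'a set \<Rightarrow> enat" where
  "esize A = (if finite A then enat (card A) else \<infinity>)"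

text \<open>Subtraction on \<^typ>\<open>enat\<close> is truncated. This matters only if all parts are empty, which is
  impossible in a connected tree-decomposition since connected graphs are non-empty.\<close>

definition width :: "'n graph \<Rightarrow> ('n \<Rightarrow> 'a set) \<Rightarrow> enat" where
  "width T V = (SUP t\<in>verts T. esize (V t)) - 1"

text \<open>The minimum is an infimum in the well-order \<^typ>\<open>enat\<close>, so it is attained unless there is
  no connected tree-decomposition at all. HOL does not allow quantification over the type of the
  nodes of the decomposition tree, so one type has to be fixed; the lemma
  \<open>connected_treewidth_le\<close> below shows that decomposition trees over any other type
  do not give a smaller width.\<close>

definition connected_treewidth :: "'a graph \<Rightarrow> enat" where
  "connected_treewidth G =
     Inf {width T V | (T :: 'a list graph) V. connected_tree_decomposition G T V}"

definition within_distance :: "'a graph \<Rightarrow> real \<Rightarrow> 'a set \<Rightarrow> 'a set \<Rightarrow> bool" where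
  "within_distance G d A B \<longleftrightarrow> (\<forall>v\<in>A. \<exists>w\<in>B. ereal_of_enat (gdist G v w) \<le> ereal d)"

definition hyperbolic :: "real \<Rightarrow> 'a graph \<Rightarrow> bool" where
  "hyperbolic d G \<longleftrightarrow>
     (\<forall>x y z Pxy Pyz Pxz.
        shortest_path G x Pxy y \<and> shortest_path G y Pyz z \<and> shortest_path G x Pxz z \<longrightarrow>
        within_distance G d (set Pxy) (set Pyz \<union> set Pxz) \<and>
        within_distance G d (set Pyz) (set Pxy \<union> set Pxz) \<and>
        within_distance G d (set Pxz) (set Pxy \<union> set Pyz))"


subsection \<open>Independence of the type of the nodes\<close>

lemma is_path_take: "is_path G p \<Longrightarrow> n > 0 \<Longrightarrow> is_path G (take n p)"
proof -
  assume p: "is_path G p" and n: "n > 0"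
  have "successively (\<lambda>u v. {u, v} \<in> edges G) (take n p @ drop n p)"
    using p by (simp add: is_path_def)
  then have "successively (\<lambda>u v. {u, v} \<in> edges G) (take n p)"
    unfolding successively_append_iff by blast
  moreover have "set (take n p) \<subseteq> verts G"
    using p set_take_subset[of n p] unfolding is_path_def by blast
  ultimately show ?thesis using p n by (simp add: is_path_def)
qed

lemma path_extend:
  assumes p: "path_between G x p y" and e: "{y, z} \<in> edges G" and z: "z \<in> verts G"
  shows "\<exists>q. path_between G x q z"
proof (cases "z \<in> set p")
  case True
  then obtain i where i: "i < length p" "p ! i = z" by (auto simp: in_set_conv_nth)
  have "is_path G (take (Suc i) p)" using p by (auto simp: path_between_def intro: is_path_take)
  moreover have "hd (take (Suc i) p) = x" using p by (simp add: path_between_def)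
  moreover have "last (take (Suc i) p) = z" using i by (simp add: take_Suc_conv_app_nth)
  ultimately show ?thesis unfolding path_between_def by blast
next
  case False
  then have "path_between G x (p @ [z]) z"
    using p e z by (auto simp: path_between_def is_path_def successively_append_iff)
  then show ?thesis by blast
qed

lemma path_trans:
  assumes "path_between G x p y" "path_between G y q z"
  shows "\<exists>r. path_between G x r z"
proof -
  have trans: "\<exists>r. path_between G x r z"
    if "is_path G q" "last q = z" "path_between G x p (hd q)" for q p
    using that
  proof (induction q arbitrary: p)
    case Nil then show ?case by (simp add: is_path_def)
  next
    case (Cons a q)
    show ?case
    proof (cases q)
      case Nil then show ?thesis using Cons.prems by auto
    next
      case q: (Cons b q')
      with Cons.prems have "{a, b} \<in> edges G" "b \<in> verts G" "is_path G q"
        by (auto simp: is_path_def)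
      moreover have "path_between G x p a" using Cons.prems(3) by simp
      ultimately obtain p' where "path_between G x p' b" using path_extend by metis
      then have "path_between G x p' (hd q)" using q by simp
      moreover have "last q = z" using Cons.prems(2) q by simp
      ultimately show ?thesis using Cons.IH \<open>is_path G q\<close> by blast
    qed
  qed
  show ?thesis by (rule trans[of q p]) (use assms in \<open>simp_all add: path_between_def\<close>)
qed

lemma is_path_rev: "is_path G p \<Longrightarrow> is_path G (rev p)"
  by (simp add: is_path_def insert_commute)

lemma path_rev: "path_between G x p y \<Longrightarrow> path_between G y (rev p) x"
  unfolding path_between_def using is_path_rev[of G p] by (auto simp: hd_rev last_rev)

lemma is_path_induced:
  "is_path (induced_subgraph G U) p \<longleftrightarrow> is_path G p \<and> set p \<subseteq> U"
proof (induction p)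
  case (Cons a p) then show ?case
    by (cases p) (auto simp: is_path_def induced_subgraph_def)
qed (simp add: is_path_def)

lemma tree_induced:
  assumes "tree T" "connected_graph (induced_subgraph T U)"
  shows "tree (induced_subgraph T U)"
proof -
  have "\<nexists>c. is_cycle (induced_subgraph T U) c"
    using assms by (auto simp: tree_def forest_def is_cycle_def is_path_induced)
      (auto simp: induced_subgraph_def)
  moreover have "simple_graph (induced_subgraph T U)"
    using assms unfolding tree_def forest_def simple_graph_def induced_subgraph_def by fastforce
  ultimately show ?thesis using assms by (simp add: tree_def forest_def)
qed

lemma connected_tree_decompositionD:
  assumes "connected_tree_decomposition G T V"
  shows "tree T" "\<forall>t\<in>verts T. V t \<subseteq> verts G"
    "verts G = (\<Union>t\<in>verts T. V t)" "\<forall>e\<in>edges G. \<exists>t\<in>verts T. e \<subseteq> V t"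
    "\<forall>t1 t2 t3 p. path_between T t1 p t3 \<and> t2 \<in> set p \<longrightarrow> V t1 \<inter> V t3 \<subseteq> V t2"
    "\<forall>t\<in>verts T. connected_graph (induced_subgraph G (V t))"
  using assms unfolding connected_tree_decomposition_def tree_decomposition_def
  by - (elim conjE, assumption)+

lemma connected_tree_decompositionI:
  assumes "tree T" "\<And>t. t \<in> verts T \<Longrightarrow> V t \<subseteq> verts G"
    "\<And>v. v \<in> verts G \<Longrightarrow> \<exists>t\<in>verts T. v \<in> V t"
    "\<And>e. e \<in> edges G \<Longrightarrow> \<exists>t\<in>verts T. e \<subseteq> V t"
    "\<And>t1 t2 t3 p. path_between T t1 p t3 \<Longrightarrow> t2 \<in> set p \<Longrightarrow> V t1 \<inter> V t3 \<subseteq> V t2"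
    "\<And>t. t \<in> verts T \<Longrightarrow> connected_graph (induced_subgraph G (V t))"
  shows "connected_tree_decomposition G T V"
proof -
  have "verts G = (\<Union>t\<in>verts T. V t)" using assms(2,3) by blast
  moreover have "\<forall>e\<in>edges G. \<exists>t\<in>verts T. e \<subseteq> V t" by (rule ballI) (rule assms(4))
  moreover have "\<forall>t\<in>verts T. V t \<subseteq> verts G" by (rule ballI) (rule assms(2))
  moreover have "\<forall>t\<in>verts T. connected_graph (induced_subgraph G (V t))"
    by (rule ballI) (rule assms(6))
  moreover have "\<forall>t1 t2 t3 p. path_between T t1 p t3 \<and> t2 \<in> set p \<longrightarrow> V t1 \<inter> V t3 \<subseteq> V t2"
    by (intro allI impI, elim conjE) (rule assms(5))
  ultimately show ?thesis
    unfolding connected_tree_decomposition_def tree_decomposition_def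
    using assms(1) by (intro conjI)
qed

lemma connected_tree_decomposition_induced:
  assumes "connected_tree_decomposition G T V" "connected_graph (induced_subgraph T U)"
    and "U \<subseteq> verts T" "\<And>v. v \<in> verts G \<Longrightarrow> \<exists>t\<in>U. v \<in> V t"
    and "\<And>e. e \<in> edges G \<Longrightarrow> \<exists>t\<in>U. e \<subseteq> V t"
  shows "connected_tree_decomposition G (induced_subgraph T U) V"
proof -
  have vU: "verts (induced_subgraph T U) = U" using assms by (auto simp: induced_subgraph_def)
  note td = connected_tree_decompositionD[OF assms(1)]
  show ?thesis
  proof (rule connected_tree_decompositionI, unfold vU)
    show "tree (induced_subgraph T U)" using td(1) assms(2) by (rule tree_induced)
  next
    fix t1 t2 t3 p assume p: "path_between (induced_subgraph T U) t1 p t3" "t2 \<in> set p"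
    then have "path_between T t1 p t3" by (simp add: path_between_def is_path_induced)
    with td(5) p(2) show "V t1 \<inter> V t3 \<subseteq> V t2" by blast
  next
    fix t assume "t \<in> U"
    then have t: "t \<in> verts T" using assms(3) by blast
    with td(2) show "V t \<subseteq> verts G" by blast
    from t td(6) show "connected_graph (induced_subgraph G (V t))" by blast
  qed (fact assms(4), fact assms(5))
qed

definition map_graph :: "('n \<Rightarrow> 'm) \<Rightarrow> 'n graph \<Rightarrow> 'm graph" where
  "map_graph f T = \<lparr>verts = f ` verts T, edges = (`) f ` edges T\<rparr>"

lemma is_path_map:
  assumes "inj_on f (verts T)" "is_path T p"
  shows "is_path (map_graph f T) (map f p)"
proof -
  have e: "{f u, f v} \<in> edges (map_graph f T)" if "{u, v} \<in> edges T" for u v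
    using imageI[OF that, of "(`) f"] by (simp add: map_graph_def)
  have "successively (\<lambda>u v. {u, v} \<in> edges T) p" using assms(2) by (simp add: is_path_def)
  then have "successively (\<lambda>u v. {f u, f v} \<in> edges (map_graph f T)) p"
    by (rule successively_mono) (use e in blast)
  then have "successively (\<lambda>u v. {u, v} \<in> edges (map_graph f T)) (map f p)"
    by (simp add: successively_map)
  with assms show ?thesis
    by (auto simp: is_path_def map_graph_def distinct_map intro: inj_on_subset)
qed

lemma map_graph_inv:
  assumes "inj_on f (verts T)" "simple_graph T"
  shows "map_graph (inv_into (verts T) f) (map_graph f T) = T"
proof -
  let ?g = "inv_into (verts T) f"
  have "?g ` f ` e = e" if "e \<in> edges T" for e
    using that assms by (intro inv_into_image_cancel) (auto simp: simple_graph_def)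
  then have "(\<lambda>e. ?g ` f ` e) ` edges T = (\<lambda>e. e) ` edges T" by (rule image_cong[OF refl])
  then have "(`) ?g ` (`) f ` edges T = edges T" by (subst image_image) simp
  then show ?thesis using assms by (simp add: map_graph_def inv_into_image_cancel)
qed

lemma connected_tree_decomposition_map:
  assumes inj: "inj_on f (verts T)" and ctd: "connected_tree_decomposition G T V"
  defines "g \<equiv> inv_into (verts T) f"
  shows "connected_tree_decomposition G (map_graph f T) (V \<circ> g)"
    and "width (map_graph f T) (V \<circ> g) = width T V"
proof -
  let ?T = "map_graph f T"
  have T: "tree T" "simple_graph T"
    using connected_tree_decompositionD(1)[OF ctd] by (auto simp: tree_def forest_def)
  have inverse: "map_graph g ?T = T" using map_graph_inv[OF inj T(2)] by (simp add: g_def)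
  have vT: "verts ?T = f ` verts T" by (simp add: map_graph_def)
  have gf: "g (f t) = t" if "t \<in> verts T" for t using that inj by (simp add: g_def)
  have injg: "inj_on g (verts ?T)" unfolding vT g_def by (rule inj_on_inv_into) simp
  have path_back: "is_path T (map g p)" if "is_path ?T p" for p
    using is_path_map[OF injg that] inverse by simp
  have "simple_graph ?T"
    unfolding simple_graph_def
  proof
    fix e assume "e \<in> edges ?T"
    then obtain e' where e': "e' \<in> edges T" "e = f ` e'" by (auto simp: map_graph_def)
    with T(2) obtain u v where "u \<in> verts T" "v \<in> verts T" "u \<noteq> v" "e' = {u, v}"
      unfolding simple_graph_def by blast
    with e' inj show "\<exists>u v. u \<in> verts ?T \<and> v \<in> verts ?T \<and> u \<noteq> v \<and> e = {u, v}"
      by (intro exI[of _ "f u"] exI[of _ "f v"]) (auto simp: vT inj_on_eq_iff)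
  qed
  moreover have "\<not> is_cycle ?T c" for c
  proof
    assume c: "is_cycle ?T c"
    then have ne: "c \<noteq> []" by (auto simp: is_cycle_def)
    have "{last c, hd c} \<in> edges ?T" using c by (simp add: is_cycle_def)
    then have "g ` {last c, hd c} \<in> edges (map_graph g ?T)" unfolding map_graph_def by auto
    with inverse ne have "{last (map g c), hd (map g c)} \<in> edges T" by (simp add: last_map hd_map)
    with c path_back have "is_cycle T (map g c)" by (auto simp: is_cycle_def)
    with T show False by (auto simp: tree_def forest_def)
  qed
  moreover have "connected_graph ?T"
    unfolding connected_graph_def
  proof (intro conjI ballI)
    show "verts ?T \<noteq> {}" using T by (simp add: vT tree_def connected_graph_def)
    fix x y assume "x \<in> verts ?T" "y \<in> verts ?T"
    then obtain u v where uv: "x = f u" "y = f v" "u \<in> verts T" "v \<in> verts T" by (auto simp: vT)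
    with T obtain p where p: "path_between T u p v" unfolding tree_def connected_graph_def by blast
    then have "path_between ?T x (map f p) y"
      using is_path_map[OF inj] uv by (auto simp: path_between_def is_path_def last_map hd_map)
    then show "\<exists>p. path_between ?T x p y" ..
  qed
  ultimately have tree: "tree ?T" by (simp add: tree_def forest_def)
  have "V (g t1) \<inter> V (g t3) \<subseteq> V (g t2)" if "path_between ?T t1 p t3" "t2 \<in> set p" for t1 t2 t3 p
  proof -
    have "path_between T (g t1) (map g p) (g t3)"
      using that path_back[of p] by (auto simp: path_between_def is_path_def last_map hd_map)
    moreover have "g t2 \<in> set (map g p)" using that by simp
    ultimately show ?thesis
      using connected_tree_decompositionD(5)[OF ctd] by blast
  qed
  note T3 = this
  note td = connected_tree_decompositionD[OF ctd]
  show "connected_tree_decomposition G ?T (V \<circ> g)"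
  proof (rule connected_tree_decompositionI)
    show "tree ?T" by (rule tree)
  next
    fix t assume "t \<in> verts ?T"
    then obtain u where u: "u \<in> verts T" "(V \<circ> g) t = V u" using vT gf by auto
    with td(2) show "(V \<circ> g) t \<subseteq> verts G" by simp
    from u td(6) show "connected_graph (induced_subgraph G ((V \<circ> g) t))" by simp
  next
    fix v assume "v \<in> verts G"
    with td(3) obtain t where "t \<in> verts T" "v \<in> V t" by blast
    with gf vT show "\<exists>t\<in>verts ?T. v \<in> (V \<circ> g) t" by auto
  next
    fix e assume "e \<in> edges G"
    with td(4) obtain t where "t \<in> verts T" "e \<subseteq> V t" by blast
    with gf vT show "\<exists>t\<in>verts ?T. e \<subseteq> (V \<circ> g) t" by auto
  qed (use T3 in auto)
  show "width ?T (V \<circ> g) = width T V"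
    by (simp add: width_def vT image_image gf cong: image_cong)
qed

lemma connected_treewidth_le:
  fixes G :: "'a graph" and T :: "'n graph"
  assumes G: "simple_graph G" and ctd: "connected_tree_decomposition G T V"
  shows "connected_treewidth G \<le> width T V"
proof -
  note td = connected_tree_decompositionD(1,3,4)[OF ctd]
  then obtain r where r: "r \<in> verts T" by (auto simp: tree_def connected_graph_def)
  define C where "C = {c :: 'a list. length c \<le> 2 \<and> (\<exists>t\<in>verts T. set c \<subseteq> V t)}"
  have "\<forall>c\<in>C. \<exists>p. path_between T r p (last p) \<and> set c \<subseteq> V (last p)"
  proof
    fix c assume "c \<in> C"
    then obtain t where "t \<in> verts T" "set c \<subseteq> V t" by (auto simp: C_def)
    moreover from this r td obtain p where "path_between T r p t"
      unfolding tree_def connected_graph_def by blast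
    ultimately show "\<exists>p. path_between T r p (last p) \<and> set c \<subseteq> V (last p)"
      by (auto simp: path_between_def)
  qed
  then obtain P where P: "\<And>c. c \<in> C \<Longrightarrow> path_between T r (P c) (last (P c))"
    and PV: "\<And>c. c \<in> C \<Longrightarrow> set c \<subseteq> V (last (P c))"
    by metis
  have Pne: "P c \<noteq> []" if "c \<in> C" for c using P[OF that] by (simp add: path_between_def is_path_def)
  define U where "U = (\<Union>c\<in>C. set (P c))"
  have UT: "U \<subseteq> verts T" using P by (auto simp: U_def path_between_def is_path_def)
  have U: "\<exists>t\<in>U. set c \<subseteq> V t" if "c \<in> C" for c
  proof -
    from that Pne have "last (P c) \<in> U" unfolding U_def by (intro UN_I[OF that] last_in_set) simp
    with PV that show ?thesis by blast
  qed
  have rU: "\<exists>p. path_between (induced_subgraph T U) r p u" if u: "u \<in> U" for u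
  proof -
    from u obtain c where c: "c \<in> C" "u \<in> set (P c)" by (auto simp: U_def)
    then obtain i where i: "i < length (P c)" "P c ! i = u" by (auto simp: in_set_conv_nth)
    have "is_path T (take (Suc i) (P c))" "hd (take (Suc i) (P c)) = r"
      using P[OF c(1)] by (auto simp: path_between_def intro: is_path_take)
    moreover have "last (take (Suc i) (P c)) = u" using i by (simp add: take_Suc_conv_app_nth)
    moreover have "set (take (Suc i) (P c)) \<subseteq> U" using c(1) set_take_subset by (fastforce simp: U_def)
    ultimately show ?thesis unfolding path_between_def is_path_induced by blast
  qed
  have "U \<noteq> {}"
  proof -
    have "[] \<in> C" using r by (auto simp: C_def)
    with U show ?thesis by blast
  qed
  moreover have "\<exists>p. path_between (induced_subgraph T U) x p y" if "x \<in> U" "y \<in> U" for x y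
    using rU[OF that(1)] rU[OF that(2)] path_rev path_trans by metis
  ultimately have conn: "connected_graph (induced_subgraph T U)"
    using UT by (auto simp: connected_graph_def induced_subgraph_def)
  have "\<exists>t\<in>U. v \<in> V t" if "v \<in> verts G" for v
  proof -
    from that td(2) obtain t where "t \<in> verts T" "v \<in> V t" by blast
    then have "[v] \<in> C" by (auto simp: C_def)
    with U[of "[v]"] show ?thesis by simp
  qed
  moreover have "\<exists>t\<in>U. e \<subseteq> V t" if e: "e \<in> edges G" for e
  proof -
    from e G obtain u v where "e = {u, v}" unfolding simple_graph_def by blast
    moreover from this e td(3) obtain t where "t \<in> verts T" "{u, v} \<subseteq> V t" by blast
    then have "[u, v] \<in> C" by (auto simp: C_def)
    ultimately show ?thesis using U[of "[u, v]"] by simp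
  qed
  ultimately have ctdU: "connected_tree_decomposition G (induced_subgraph T U) V"
    using connected_tree_decomposition_induced[OF ctd conn UT] by blast
  have vU: "verts (induced_subgraph T U) = U" using UT by (auto simp: induced_subgraph_def)

  define h :: "'a list \<times> nat \<Rightarrow> 'a list" where
    "h = (\<lambda>(c, i). c @ replicate (3 * i) undefined)"
  have hinj: "c = c' \<and> i = i'" if "h (c, i) = h (c', i')" "length c \<le> 2" "length c' \<le> 2" for c c' i i'
  proof -
    have "length c + 3 * i = length c' + 3 * i'"
      using arg_cong[OF that(1), of length] by (simp add: h_def)
    with that(2,3) have "i = i'" "length c = length c'" by presburger+
    with that(1) show ?thesis by (simp add: h_def)
  qed
  have "\<forall>u\<in>U. \<exists>ci. fst ci \<in> C \<and> P (fst ci) ! snd ci = u"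
  proof
    fix u assume "u \<in> U"
    then obtain c where c: "c \<in> C" "u \<in> set (P c)" by (auto simp: U_def)
    then obtain i where "P c ! i = u" by (auto simp: in_set_conv_nth)
    with c(1) show "\<exists>ci. fst ci \<in> C \<and> P (fst ci) ! snd ci = u" by (intro exI[of _ "(c, i)"]) simp
  qed
  then obtain k where k: "\<And>u. u \<in> U \<Longrightarrow> fst (k u) \<in> C \<and> P (fst (k u)) ! snd (k u) = u"
    by metis
  have "inj_on (h \<circ> k) U"
  proof (rule inj_onI)
    fix u u' assume u: "u \<in> U" "u' \<in> U" "(h \<circ> k) u = (h \<circ> k) u'"
    with k have "length (fst (k u)) \<le> 2" "length (fst (k u')) \<le> 2" by (auto simp: C_def)
    with hinj[of "fst (k u)" "snd (k u)" "fst (k u')" "snd (k u')"] u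
    have "k u = k u'" by (auto intro: prod_eqI)
    with k u show "u = u'" by metis
  qed
  then have inj: "inj_on (h \<circ> k) (verts (induced_subgraph T U))" by (simp add: vU)
  note m = connected_tree_decomposition_map[OF inj ctdU]
  have "connected_treewidth G \<le> width (induced_subgraph T U) V"
    unfolding connected_treewidth_def by (intro Inf_lower CollectI exI conjI, rule m(2)[symmetric], rule m(1))
  also have "\<dots> \<le> width T V"
  proof -
    have "(SUP t\<in>U. esize (V t)) \<le> (SUP t\<in>verts T. esize (V t))" by (rule SUP_subset_mono[OF UT]) simp
    then show ?thesis unfolding width_def vU
      by (cases "SUP t\<in>U. esize (V t)"; cases "SUP t\<in>verts T. esize (V t)")
        (auto simp: one_enat_def)
  qed
  finally show ?thesis .
qed

end

theory Submission
  imports Defs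
begin

text \<open>Three pairwise intersecting subtrees of a tree have a common node. In a connected
  tree-decomposition, the nodes whose parts meet a given path form a subtree. For a vertex \<open>v\<close> on
  the side \<open>P\<close> of a geodesic triangle, apply this to the two segments of \<open>P\<close> at \<open>v\<close> and to the
  union of the other two sides: a single part meets all three, and as this part is connected
  with at most \<open>k + 1\<close> vertices, \<open>v\<close> has distance at most \<open>k\<close> from the other sides. Applied
  to two consecutive vertices of a cycle and the remainder of it, the same argument yields a part
  with three vertices.

  The bound is attained by a ladder with rungs of \<open>k\<close> vertices in which two neighbouring rungs
  share all vertices but their upper ends, these two being joined by a path through one further
  vertex \<open>v\<close>. It has a connected path-decomposition of width \<open>k\<close>, and its connected tree-width is
  not smaller since \<open>v\<close> has distance \<open>k\<close> from two sides of a geodesic triangle.\<close>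

section \<open>Paths in forests\<close>

lemma is_path_append:
  "is_path G (p @ q) \<longleftrightarrow>
     (if p = [] then is_path G q else if q = [] then is_path G p
      else is_path G p \<and> is_path G q \<and> set p \<inter> set q = {} \<and> {last p, hd q} \<in> edges G)"
  by (auto simp: is_path_def successively_append_iff)

lemma is_path_Cons:
  "is_path G (x # p) \<longleftrightarrow>
     x \<in> verts G \<and> x \<notin> set p \<and> (p = [] \<or> {x, hd p} \<in> edges G \<and> is_path G p)"
  by (cases p) (auto simp: is_path_def)

lemma path_between_ends: "path_between G x p y \<Longrightarrow> x \<in> set p \<and> y \<in> set p"
  unfolding path_between_def is_path_def by (metis hd_in_set last_in_set)

text \<open>\<open>s\<close> is the first vertex of \<open>p\<close> that lies on \<open>q\<close>.
  The part of \<open>p\<close> before \<open>s\<close> therefore avoids \<open>q\<close>, so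
  following \<open>p\<close> up to \<open>s\<close> and \<open>q\<close> from there repeats no
  vertex.\<close>

lemma path_join:
  assumes "path_between G x p y" "path_between G y q z"
  obtains s p1 p2 q1 q2 where "p = p1 @ s # p2" "q = q1 @ s # q2"
    "set p1 \<inter> set q = {}" "path_between G x (p1 @ s # q2) z"
proof -
  have "\<exists>s\<in>set p. s \<in> set q"
    using path_between_ends[OF assms(1)] path_between_ends[OF assms(2)] by blast
  then obtain p1 s p2 where p: "p = p1 @ s # p2" and s: "s \<in> set q"
    and p1: "\<forall>t\<in>set p1. t \<notin> set q"
    using split_list_first_prop[of p "\<lambda>s. s \<in> set q"] by blast
  from s obtain q1 q2 where q: "q = q1 @ s # q2" by (auto dest: split_list)
  have "path_between G x (p1 @ s # q2) z"
    using assms p1 unfolding p q path_between_def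
    by (auto simp: is_path_append is_path_Cons hd_append split: if_splits)
  with that p q p1 show ?thesis by blast
qed

lemma path_join_length:
  assumes "path_between G x p y" "path_between G y q z"
  obtains r where "path_between G x r z" "path_length r \<le> path_length p + path_length q"
proof -
  obtain s p1 p2 q1 q2 where "p = p1 @ s # p2" "q = q1 @ s # q2" "path_between G x (p1 @ s # q2) z"
    by (rule path_join[OF assms])
  with that[of "p1 @ s # q2"] show ?thesis by (simp add: path_length_def)
qed

text \<open>By induction along \<open>p\<close>: common first vertices are stripped off, and where
  the paths diverge, the first vertex of one that lies again on the other closes a cycle.\<close>

lemma forest_path_unique:
  assumes G: "forest G" and "path_between G x p y" "path_between G x q y"
  shows "p = q"
  using assms(2,3)
proof (induction p arbitrary: x q)
  case Nil
  then show ?case by (simp add: path_between_def is_path_def)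
next
  case (Cons x' p)
  then have [simp]: "x' = x" by (simp add: path_between_def)
  from Cons.prems obtain q' where q: "q = x # q'"
    by (cases q) (auto simp: path_between_def is_path_def)
  have 1: "is_path G (x # p)" "is_path G (x # q')" "last (x # p) = y" "last (x # q') = y"
    using Cons.prems unfolding q path_between_def by auto
  show ?case
  proof (cases "p = [] \<or> q' = []")
    case True
    then show ?thesis using 1 unfolding q by (auto simp: is_path_Cons dest: last_in_set split: if_splits)
  next
    case False
    show ?thesis
    proof (cases "hd p = hd q'")
      case True
      then show ?thesis
        using Cons.IH[of "hd p" q'] 1 False unfolding q by (auto simp: path_between_def is_path_Cons)
    next
      case hd: False
      from 1 False have "\<exists>s\<in>set p. s \<in> set q'" by (auto intro!: bexI[of _ y] dest: last_in_set)
      then obtain p1 s p2 where p: "p = p1 @ s # p2" and s: "s \<in> set q'"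
        and p1: "\<forall>t\<in>set p1. t \<notin> set q'"
        using split_list_first_prop[of p "\<lambda>s. s \<in> set q'"] by blast
      from s obtain q1 q2 where q': "q' = q1 @ s # q2" by (auto dest: split_list)
      \<comment> \<open>Not both are empty since the second vertices differ; this gives the cycle
        below its third vertex.\<close>
      have ne: "p1 \<noteq> [] \<or> q1 \<noteq> []" using hd p q' by auto
      have "is_path G (x # p1 @ [s])" "is_path G (x # q1 @ [s])"
        using 1 unfolding p q' by (auto simp: is_path_append is_path_Cons hd_append split: if_splits)
      moreover from this(2) have "is_path G (rev q1)" if "q1 \<noteq> []"
        using that by (auto simp: is_path_append is_path_Cons intro!: is_path_rev)
      ultimately have "is_path G ((x # p1 @ [s]) @ rev q1)"
        using p1 1(2) unfolding q'
        by (subst is_path_append) (auto simp: is_path_append is_path_Cons hd_rev insert_commute split: if_splits)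
      moreover have "{last ((x # p1 @ [s]) @ rev q1), x} \<in> edges G"
        using 1(2) unfolding q' by (auto simp: is_path_Cons last_rev hd_append insert_commute split: if_splits)
      moreover have "length ((x # p1 @ [s]) @ rev q1) \<ge> 3" using ne by (cases p1; cases q1) auto
      ultimately have "is_cycle G ((x # p1 @ [s]) @ rev q1)" by (simp add: is_cycle_def)
      with G show ?thesis by (auto simp: forest_def)
    qed
  qed
qed

text \<open>By uniqueness \<open>r\<close> is the join of \<open>p\<close> and \<open>q\<close>; the
  vertex where it changes from one to the other is the median of \<open>x\<close>, \<open>y\<close>,
  \<open>z\<close>.\<close>

lemma forest_path_median:
  assumes "forest G" "path_between G x p y" "path_between G y q z" "path_between G x r z"
  shows "set r \<subseteq> set p \<union> set q" and "set p \<inter> set q \<inter> set r \<noteq> {}"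
proof -
  obtain s p1 p2 q1 q2 where s: "p = p1 @ s # p2" "q = q1 @ s # q2"
    and "path_between G x (p1 @ s # q2) z"
    by (rule path_join[OF assms(2,3)])
  then have "r = p1 @ s # q2" using forest_path_unique assms by metis
  with s show "set r \<subseteq> set p \<union> set q" "set p \<inter> set q \<inter> set r \<noteq> {}" by auto
qed

lemma tree_path: "tree T \<Longrightarrow> s \<in> verts T \<Longrightarrow> t \<in> verts T \<Longrightarrow> \<exists>p. path_between T s p t"
  unfolding tree_def connected_graph_def by blast

section \<open>Subtrees of a tree and their Helly property\<close>

text \<open>In a tree these are the vertex sets of subtrees, the empty set included. Stated by
  paths, the notion matches the form of (T3).\<close>

definition path_convex :: "'n graph \<Rightarrow> 'n set \<Rightarrow> bool" where
  "path_convex T S \<longleftrightarrow> S \<subseteq> verts T \<and>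
     (\<forall>s\<in>S. \<forall>t\<in>S. \<forall>p. path_between T s p t \<longrightarrow> set p \<subseteq> S)"

text \<open>A path from \<open>A\<close> to \<open>B\<close> is covered by the path to the common
  node \<open>m\<close>, which stays in \<open>A\<close>, and the one from \<open>m\<close>, which
  stays in \<open>B\<close>.\<close>

lemma path_convex_Un:
  assumes T: "tree T" and S: "path_convex T A" "path_convex T B" and m: "m \<in> A" "m \<in> B"
  shows "path_convex T (A \<union> B)"
proof -
  have mixed: "set p \<subseteq> A \<union> B" if "s \<in> A" "t \<in> B" "path_between T s p t" for s t p
  proof -
    have "s \<in> verts T" "t \<in> verts T" "m \<in> verts T" using that S m by (auto simp: path_convex_def)
    then obtain q r where qr: "path_between T s q m" "path_between T m r t"
      using tree_path[OF T] by metis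
    then have "set q \<subseteq> A" "set r \<subseteq> B" using that S m by (auto simp: path_convex_def)
    then show ?thesis
      using forest_path_median(1)[OF _ qr that(3)] T by (auto simp: tree_def)
  qed
  have "set p \<subseteq> A \<union> B" if st: "s \<in> A \<union> B" "t \<in> A \<union> B" "path_between T s p t" for s t p
  proof -
    consider "s \<in> A" "t \<in> A" | "s \<in> B" "t \<in> B" | "s \<in> A" "t \<in> B" | "t \<in> A" "s \<in> B"
      using st(1,2) by blast
    then show ?thesis
    proof cases
      case 4
      then show ?thesis using mixed[of t s "rev p"] path_rev[OF st(3)] by auto
    next
      case 1
      with S(1) st(3) show ?thesis unfolding path_convex_def by blast
    next
      case 2
      with S(2) st(3) show ?thesis unfolding path_convex_def by blast
    next
      case 3
      with st(3) show ?thesis by (intro mixed)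
    qed
  qed
  then show ?thesis using S unfolding path_convex_def by blast
qed

text \<open>Choose one node in each pairwise intersection. The path between two of them stays in the
  set that contains both, so their median lies in all three sets.\<close>

lemma path_convex_Helly:
  assumes T: "tree T" and S: "path_convex T A" "path_convex T B" "path_convex T C"
    and "A \<inter> B \<noteq> {}" "B \<inter> C \<noteq> {}" "A \<inter> C \<noteq> {}"
  shows "A \<inter> B \<inter> C \<noteq> {}"
proof -
  from assms(5-7) obtain x y z where
    xyz: "x \<in> A" "x \<in> B" "y \<in> B" "y \<in> C" "z \<in> A" "z \<in> C" by blast
  then have "x \<in> verts T" "y \<in> verts T" "z \<in> verts T" using S by (auto simp: path_convex_def)
  then obtain p q r where p: "path_between T x p y" "path_between T y q z" "path_between T x r z"
    using tree_path[OF T] by metis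
  then have "set p \<subseteq> B" "set q \<subseteq> C" "set r \<subseteq> A" using xyz S by (auto simp: path_convex_def)
  moreover have "set p \<inter> set q \<inter> set r \<noteq> {}"
    using forest_path_median(2)[OF _ p] T by (simp add: tree_def)
  ultimately show ?thesis by blast
qed

section \<open>Parts meeting a path\<close>

definition parts_meeting :: "'n graph \<Rightarrow> ('n \<Rightarrow> 'a set) \<Rightarrow> 'a set \<Rightarrow> 'n set" where
  "parts_meeting T V A = {t \<in> verts T. V t \<inter> A \<noteq> {}}"

lemma parts_meeting_Un: "parts_meeting T V (A \<union> B) = parts_meeting T V A \<union> parts_meeting T V B"
  by (auto simp: parts_meeting_def)

lemma parts_meeting_ne:
  assumes "connected_tree_decomposition G T V" "a \<in> A" "a \<in> B" "a \<in> verts G"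
  shows "parts_meeting T V A \<inter> parts_meeting T V B \<noteq> {}"
  using assms connected_tree_decompositionD(3)[OF assms(1)] by (auto simp: parts_meeting_def)

lemma parts_meeting_edge:
  assumes "connected_tree_decomposition G T V" "a \<in> A" "b \<in> B" "{a, b} \<in> edges G"
  shows "parts_meeting T V A \<inter> parts_meeting T V B \<noteq> {}"
proof -
  obtain t where "t \<in> verts T" "{a, b} \<subseteq> V t"
    using connected_tree_decompositionD(4)[OF assms(1)] assms(4) by blast
  with assms show ?thesis by (auto simp: parts_meeting_def)
qed

text \<open>A single vertex gives a subtree by (T3). Each edge of the path lies in some part, so the
  subtrees of consecutive vertices share a node and the union remains a subtree.\<close>

lemma path_convex_parts_meeting_path:
  assumes ctd: "connected_tree_decomposition G T V" and "is_path G p"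
  shows "path_convex T (parts_meeting T V (set p))"
  using assms(2)
proof (induction p)
  case Nil
  then show ?case by (simp add: is_path_def)
next
  case (Cons a p)
  note td = connected_tree_decompositionD[OF ctd]
  have "set q \<subseteq> verts T" if "path_between T s q t" for s q t
    using that by (simp add: path_between_def is_path_def)
  then have a: "path_convex T (parts_meeting T V {a})"
    using td(5) unfolding path_convex_def parts_meeting_def by blast
  show ?case
  proof (cases "p = []")
    case True
    with a show ?thesis by simp
  next
    case False
    with Cons have p: "path_convex T (parts_meeting T V (set p))" "{a, hd p} \<in> edges G"
      by (auto simp: is_path_Cons)
    with False parts_meeting_edge[OF ctd, of a "{a}" "hd p" "set p"]
    obtain m where "m \<in> parts_meeting T V {a}" "m \<in> parts_meeting T V (set p)" by auto
    from path_convex_Un[OF td(1) a p(1) this] show ?thesis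
      by (simp add: parts_meeting_Un[symmetric])
  qed
qed

text \<open>The truncated subtraction does no harm here: a width of at most \<open>k\<close> bounds
  the supremum of the sizes by \<open>Suc k\<close> in every case.\<close>

lemma width_le_card:
  assumes "width T V \<le> enat k" "t \<in> verts T"
  shows "finite (V t)" "card (V t) \<le> Suc k"
proof -
  have "esize (V t) \<le> (SUP t\<in>verts T. esize (V t))" using assms(2) by (rule SUP_upper)
  moreover have "(SUP t\<in>verts T. esize (V t)) \<le> enat (Suc k)"
    using assms(1) unfolding width_def
    by (cases "SUP t\<in>verts T. esize (V t)") (auto simp: one_enat_def)
  ultimately have "esize (V t) \<le> enat (Suc k)" by (rule order_trans)
  then show "finite (V t)" "card (V t) \<le> Suc k" by (auto simp: esize_def split: if_splits)
qed

text \<open>The infimum of the empty set is \<infinity>, so a finite one belongs to a non-empty set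
  of widths, and in a well-order it is attained.\<close>

lemma connected_treewidth_attained:
  fixes G :: "'a graph"
  assumes "connected_treewidth G = enat k"
  obtains T :: "'a list graph" and V where "connected_tree_decomposition G T V" "width T V = enat k"
proof -
  let ?W = "{width T V | (T :: 'a list graph) V. connected_tree_decomposition G T V}"
  have "?W \<noteq> {}"
  proof
    assume "?W = {}"
    then have "connected_treewidth G = \<infinity>" unfolding connected_treewidth_def by (metis Inf_empty top_enat_def)
    with assms show False by simp
  qed
  then have "Inf ?W \<in> ?W" by (metis (mono_tags, lifting) Inf_enat_def LeastI ex_in_conv)
  with assms that show ?thesis unfolding connected_treewidth_def by auto
qed

lemma forest_if_width_1:
  assumes G: "simple_graph G" and ctd: "connected_tree_decomposition G T V" and w: "width T V \<le> 1"
  shows "forest G"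
  unfolding forest_def
proof (intro conjI notI G)
  assume "\<exists>c. is_cycle G c"
  then obtain c where c: "is_cycle G c" ..
  then obtain a b p where abp: "c = a # b # p" "p \<noteq> []"
    by (cases c; cases "tl c"; cases "tl (tl c)") (auto simp: is_cycle_def)
  with c have p: "is_path G [a]" "is_path G [b]" "is_path G p" "a \<noteq> b" "a \<notin> set p" "b \<notin> set p"
    "{a, b} \<in> edges G" "{b, hd p} \<in> edges G" "{a, last p} \<in> edges G"
    by (auto simp: is_cycle_def is_path_Cons insert_commute split: if_splits)
  let ?m = "parts_meeting T V"
  note conv = path_convex_parts_meeting_path[OF ctd p(1)] path_convex_parts_meeting_path[OF ctd p(2)]
    path_convex_parts_meeting_path[OF ctd p(3)]
  \<comment> \<open>The arcs \<open>a\<close>, \<open>b\<close> and \<open>p\<close> make up the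
    cycle, and any two of them are joined by one of its edges, so their subtrees pairwise
    intersect.\<close>
  have "?m (set [a]) \<inter> ?m (set [b]) \<inter> ?m (set p) \<noteq> {}"
    by (rule path_convex_Helly[OF connected_tree_decompositionD(1)[OF ctd] conv])
      (rule parts_meeting_edge[OF ctd _ _ p(7)] parts_meeting_edge[OF ctd _ _ p(8)]
        parts_meeting_edge[OF ctd _ _ p(9)]; use abp(2) in simp)+
  then obtain t d where t: "t \<in> verts T" "a \<in> V t" "b \<in> V t" "d \<in> V t" "d \<in> set p"
    by (auto simp: parts_meeting_def)
  have "card {a, b, d} = 3" using p t by (auto simp: card_insert_if)
  moreover have "card {a, b, d} \<le> card (V t)" using t width_le_card(1)[of T V 1] w
    by (intro card_mono) (auto simp: one_enat_def)
  ultimately show False using width_le_card(2)[of T V 1 t] w t by (simp add: one_enat_def)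
qed

section \<open>Distances\<close>

lemma gdist_le: "path_between G x p y \<Longrightarrow> gdist G x y \<le> enat (path_length p)"
  unfolding gdist_def by (rule INF_lower) simp

lemma gdist_same: "v \<in> verts G \<Longrightarrow> gdist G v v = 0"
  using gdist_le[of G v "[v]" v]
  by (simp add: path_between_def is_path_def path_length_def zero_enat_def[symmetric])

lemma ereal_of_enat_le_real: "n \<le> enat k \<Longrightarrow> ereal_of_enat n \<le> ereal (real k)"
  by (cases n) auto

text \<open>The median property places each side inside the union of the other two.\<close>

lemma forest_0_hyperbolic:
  assumes "forest G"
  shows "hyperbolic 0 G"
  unfolding hyperbolic_def
proof (intro allI impI)
  fix x y z p q r assume "shortest_path G x p y \<and> shortest_path G y q z \<and> shortest_path G x r z"
  then have p: "path_between G x p y" "path_between G y q z" "path_between G x r z"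
    by (auto simp: shortest_path_def)
  have within: "within_distance G 0 A B" if "A \<subseteq> verts G" "A \<subseteq> B" for A B
    using that gdist_same[of _ G] unfolding within_distance_def
    by (intro ballI bexI) (auto simp: zero_ereal_def[symmetric])
  have "set p \<subseteq> set q \<union> set r" "set q \<subseteq> set p \<union> set r" "set r \<subseteq> set p \<union> set q"
    using forest_path_median(1)[OF assms p] forest_path_median(1)[OF assms p(3) path_rev[OF p(2)] p(1)]
      forest_path_median(1)[OF assms path_rev[OF p(1)] p(3) p(2)] by auto
  moreover have "set p \<subseteq> verts G" "set q \<subseteq> verts G" "set r \<subseteq> verts G"
    using p by (auto simp: path_between_def is_path_def)
  ultimately show "within_distance G 0 (set p) (set q \<union> set r) \<and>
    within_distance G 0 (set q) (set p \<union> set r) \<and> within_distance G 0 (set r) (set p \<union> set q)"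
    using within by blast
qed

section \<open>Geodesic triangles and connected parts\<close>

text \<open>\<open>s\<close> is the first vertex of \<open>q\<close> on \<open>p\<close>, and
  \<alpha>, \<beta>, \<gamma> are the lengths of the legs from \<open>s\<close> to \<open>a\<close>,
  \<open>b\<close>, \<open>c\<close>. The legs meet only in \<open>s\<close>, so the tripod has
  \<alpha> + \<beta> + \<gamma> + 1 vertices, whence the strict inequality.\<close>

lemma tripod:
  assumes "path_between G a p b" "path_between G c q a"
  obtains \<alpha> \<beta> \<gamma> pa pb where
    "path_between G c pa a" "path_length pa = \<gamma> + \<alpha>"
    "path_between G c pb b" "path_length pb = \<gamma> + \<beta>"
    "path_length p = \<alpha> + \<beta>" "\<alpha> + \<beta> + \<gamma> < card (set p \<union> set q)"
proof -
  obtain s q1 q2 p1 p2 where q: "q = q1 @ s # q2" and p: "p = p1 @ s # p2"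
    and q1: "set q1 \<inter> set p = {}" and pb: "path_between G c (q1 @ s # p2) b"
    by (rule path_join[OF assms(2,1)])
  have "is_path G (q1 @ [s])" "is_path G (p1 @ [s])"
    using assms unfolding p q path_between_def by (auto simp: is_path_append is_path_Cons split: if_splits)
  then have "is_path G (q1 @ [s] @ rev p1)"
    using q1 is_path_rev[of G "p1 @ [s]"] unfolding p by (auto simp: is_path_append split: if_splits)
  then have pa: "path_between G c (q1 @ s # rev p1) a"
    using assms pb unfolding p path_between_def by (auto simp: last_rev hd_append)
  have d: "distinct p" "distinct q" using assms by (auto simp: path_between_def is_path_def)
  have "card (set q1 \<union> set p) = length q1 + length p"
    using d q1 by (subst card_Un_disjoint) (auto simp: q distinct_card)
  moreover have "card (set q1 \<union> set p) \<le> card (set p \<union> set q)"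
    by (intro card_mono) (auto simp: q)
  ultimately show ?thesis
    using that[OF pa _ pb, of "length q1" "length p1" "length p2"] by (simp add: path_length_def p)
qed

lemma is_path_drop:
  assumes "is_path G p" "n < length p"
  shows "is_path G (drop n p)"
  using assms append_take_drop_id[of n p] is_path_append[of G "take n p" "drop n p"]
  by (auto split: if_splits)

lemma is_path_segment:
  assumes "is_path G p" "i \<le> j" "j < length p"
  shows "path_between G (p ! i) (take (Suc (j - i)) (drop i p)) (p ! j)"
proof -
  have "is_path G (take (Suc (j - i)) (drop i p))" using assms by (intro is_path_take is_path_drop) auto
  moreover have "hd (take (Suc (j - i)) (drop i p)) = p ! i" using assms by (simp add: hd_drop_conv_nth)
  moreover have "last (take (Suc (j - i)) (drop i p)) = p ! j" using assms by (simp add: take_Suc_conv_app_nth)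
  ultimately show ?thesis by (simp add: path_between_def)
qed

text \<open>Otherwise \<open>q\<close> could replace the segment between the indices
  \<open>i\<close> and \<open>j\<close> and yield a shorter path from \<open>x\<close> to
  \<open>y\<close>; joining by \<open>path_join_length\<close> avoids repeated vertices without
  adding length.\<close>

lemma shortest_path_segment:
  assumes p: "shortest_path G x p y" and ij: "i \<le> j" "j < length p"
    and q: "path_between G (p ! i) q (p ! j)"
  shows "j - i \<le> path_length q"
proof -
  have path: "is_path G p" and xy: "hd p = x" "last p = y" and ne: "p \<noteq> []"
    using p by (auto simp: shortest_path_def path_between_def is_path_def)
  have 1: "path_between G x (take (Suc i) p) (p ! i)"
    using is_path_segment[OF path, of 0 i] ij ne xy by (simp add: hd_conv_nth)
  have 2: "path_between G (p ! j) (drop j p) y"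
    using path ij xy by (simp add: path_between_def is_path_drop hd_drop_conv_nth)
  obtain r where r: "path_between G x r (p ! j)" "path_length r \<le> i + path_length q"
    using path_join_length[OF 1 q] ij by (auto simp: path_length_def)
  obtain s where s: "path_between G x s y" "path_length s \<le> path_length r + path_length (drop j p)"
    by (rule path_join_length[OF r(1) 2])
  have "path_length p \<le> path_length s" using p s by (auto simp: shortest_path_def)
  then show ?thesis using r s ij by (simp add: path_length_def)
qed

text \<open>For \<open>v\<close> on the side \<open>P\<close>, some part contains vertices \<open>a\<close>, \<open>b\<close>, \<open>c\<close> of the initial segment of
  \<open>P\<close> up to \<open>v\<close>, of its final segment from \<open>v\<close>, and of the union of the other sides. A tripod in
  this part shows that \<open>d(v,a) + d(a,c)\<close> and \<open>d(v,b) + d(b,c)\<close> add up to at most \<open>2k\<close>.\<close>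
lemma side_within_distance:
  assumes ctd: "connected_tree_decomposition G T V" and w: "width T V \<le> enat k"
    and P: "shortest_path G x P y" and Q: "path_between G x Q z" and R: "path_between G y R z"
  shows "within_distance G (real k) (set P) (set Q \<union> set R)"
  unfolding within_distance_def
proof
  fix v assume "v \<in> set P"
  then obtain n where n: "n < length P" "P ! n = v" by (auto simp: in_set_conv_nth)
  have path: "is_path G P" and xy: "hd P = x" "last P = y" and ne: "P \<noteq> []"
    using P by (auto simp: shortest_path_def path_between_def is_path_def)
  have QR: "is_path G Q" "is_path G R" "x \<in> set Q" "y \<in> set R" "z \<in> set Q" "z \<in> set R"
    using Q R path_between_ends[OF Q] path_between_ends[OF R] by (auto simp: path_between_def)
  have verts: "x \<in> verts G" "y \<in> verts G" "z \<in> verts G" "v \<in> verts G"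
    using QR path \<open>v \<in> set P\<close> by (auto simp: is_path_def)
  let ?m = "parts_meeting T V" and ?A = "take (Suc n) P" and ?B = "drop n P"
  note conv = path_convex_parts_meeting_path[OF ctd]
  note tree = connected_tree_decompositionD(1)[OF ctd]
  have A: "path_convex T (?m (set ?A))" and B: "path_convex T (?m (set ?B))"
    using path n by (auto intro!: conv is_path_take is_path_drop)
  \<comment> \<open>\<open>Q\<close> and \<open>R\<close> meet in \<open>z\<close>, so the nodes
    belonging to their union form a single subtree.\<close>
  obtain m where "m \<in> ?m (set Q)" "m \<in> ?m (set R)"
    using parts_meeting_ne[OF ctd QR(5,6) verts(3)] by blast
  from path_convex_Un[OF tree conv[OF QR(1)] conv[OF QR(2)] this]
  have C: "path_convex T (?m (set Q \<union> set R))" by (simp add: parts_meeting_Un)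
  have xA: "x \<in> set ?A" "y \<in> set ?B" "v \<in> set ?A" "v \<in> set ?B"
  proof -
    show "x \<in> set ?A" using xy ne by (cases P) auto
    show "y \<in> set ?B" using xy n by (metis drop_eq_Nil last_drop last_in_set not_le)
    show "v \<in> set ?A" using n by (auto simp: take_Suc_conv_app_nth)
    show "v \<in> set ?B" using n by (metis drop_eq_Nil hd_drop_conv_nth hd_in_set not_le)
  qed
  have "?m (set ?A) \<inter> ?m (set ?B) \<inter> ?m (set Q \<union> set R) \<noteq> {}"
  proof (rule path_convex_Helly[OF tree A B C])
    show "?m (set ?A) \<inter> ?m (set ?B) \<noteq> {}" by (rule parts_meeting_ne[OF ctd xA(3,4) verts(4)])
    show "?m (set ?B) \<inter> ?m (set Q \<union> set R) \<noteq> {}"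
      by (rule parts_meeting_ne[OF ctd xA(2) _ verts(2)]) (use QR in simp)
    show "?m (set ?A) \<inter> ?m (set Q \<union> set R) \<noteq> {}"
      by (rule parts_meeting_ne[OF ctd xA(1) _ verts(1)]) (use QR in simp)
  qed
  then obtain t a b c where t: "t \<in> verts T" "a \<in> V t" "b \<in> V t" "c \<in> V t"
    and abc: "a \<in> set ?A" "b \<in> set ?B" "c \<in> set Q \<union> set R"
    by (auto simp: parts_meeting_def)
  from abc(1) n obtain i where i: "i \<le> n" "P ! i = a" by (auto simp: in_set_conv_nth less_Suc_eq_le)
  from abc(2) n obtain j' where "j' < length P - n" "P ! (n + j') = b" by (auto simp: in_set_conv_nth)
  then obtain j where j: "n \<le> j" "j < length P" "P ! j = b" by (metis add.commute le_add1 less_diff_conv)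
  let ?H = "induced_subgraph G (V t)"
  have H: "connected_graph ?H" using connected_tree_decompositionD(6)[OF ctd] t by blast
  have VG: "V t \<subseteq> verts G" using connected_tree_decompositionD(2)[OF ctd] t by blast
  \<comment> \<open>Here the connectedness of the part enters: both paths stay inside
    \<open>V t\<close>, so the tripod in their union has at most \<open>k + 1\<close>
    vertices.\<close>
  obtain p q where pq: "path_between ?H a p b" "path_between ?H c q a"
    using H t VG unfolding connected_graph_def by (auto simp: induced_subgraph_def) blast
  have lift: "path_between G u r u'" if "path_between ?H u r u'" for u r u'
    using that by (simp add: path_between_def is_path_induced)
  obtain \<alpha> \<beta> \<gamma> pa pb where tri: "path_between ?H c pa a" "path_length pa = \<gamma> + \<alpha>"
    "path_between ?H c pb b" "path_length pb = \<gamma> + \<beta>"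
    "path_length p = \<alpha> + \<beta>" "\<alpha> + \<beta> + \<gamma> < card (set p \<union> set q)"
    by (rule tripod[OF pq])
  have "card (set p \<union> set q) \<le> card (V t)"
    using pq width_le_card(1)[OF w t(1)] by (intro card_mono) (auto simp: path_between_def is_path_induced)
  then have le: "\<alpha> + \<beta> + \<gamma> \<le> k" using tri(6) width_le_card(2)[OF w t(1)] by linarith
  \<comment> \<open>\<open>P\<close> is shortest, so its stretch from \<open>a\<close> to
    \<open>b\<close> is no longer than the detour through the part.\<close>
  have ji: "j - i \<le> \<alpha> + \<beta>"
    using shortest_path_segment[OF P, of i j p] i j lift[OF pq(1)] tri(5) by simp
  have va: "path_between G a (take (Suc (n - i)) (drop i P)) v"
    and vb: "path_between G v (take (Suc (j - n)) (drop n P)) b"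
    using is_path_segment[OF path, of i n] is_path_segment[OF path, of n j] i j n by simp_all
  obtain r where r: "path_between G c r v"
    "path_length r \<le> path_length pa + path_length (take (Suc (n - i)) (drop i P))"
    by (rule path_join_length[OF lift[OF tri(1)] va])
  obtain r' where r': "path_between G v r' c"
    "path_length r' \<le> path_length (take (Suc (j - n)) (drop n P)) + path_length (rev pb)"
    by (rule path_join_length[OF vb path_rev[OF lift[OF tri(3)]]])
  have "path_length (take (Suc (n - i)) (drop i P)) = n - i"
    "path_length (take (Suc (j - n)) (drop n P)) = j - n"
    using i n j by (auto simp: path_length_def min_def)
  moreover have "path_length (rev pb) = path_length pb" "path_length (rev r) = path_length r"
    by (simp_all add: path_length_def)
  ultimately have len: "path_length (rev r) \<le> \<gamma> + \<alpha> + (n - i)" "path_length r' \<le> \<gamma> + \<beta> + (j - n)"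
    using r(2) r'(2) tri(2,4) by linarith+
  have "gdist G v c \<le> enat (\<gamma> + \<alpha> + (n - i))"
    using gdist_le[OF path_rev[OF r(1)]] len(1) by (meson enat_ord_simps(1) order_trans)
  moreover have "gdist G v c \<le> enat (\<gamma> + \<beta> + (j - n))"
    using gdist_le[OF r'(1)] len(2) by (meson enat_ord_simps(1) order_trans)
  \<comment> \<open>The two bounds sum to 2\<gamma> + \<alpha> + \<beta> + (j - i), which is at most
    2(\<alpha> + \<beta> + \<gamma>) and hence at most 2k, so one of them is at most k.\<close>
  moreover have "\<gamma> + \<alpha> + (n - i) \<le> k \<or> \<gamma> + \<beta> + (j - n) \<le> k" using le ji i j by linarith
  ultimately have "gdist G v c \<le> enat k" by (meson enat_ord_simps(1) order_trans)
  then have "ereal_of_enat (gdist G v c) \<le> ereal (real k)" by (rule ereal_of_enat_le_real)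
  with abc(3) show "\<exists>w\<in>set Q \<union> set R. ereal_of_enat (gdist G v w) \<le> ereal (real k)" by blast
qed

lemma hyperbolic_if_width_le:
  assumes ctd: "connected_tree_decomposition G T V" and w: "width T V \<le> enat k"
  shows "hyperbolic (real k) G"
  unfolding hyperbolic_def
proof (intro allI impI)
  fix x y z p q r assume "shortest_path G x p y \<and> shortest_path G y q z \<and> shortest_path G x r z"
  then have s: "shortest_path G x p y" "shortest_path G y q z" "shortest_path G x r z"
    and p: "path_between G x p y" "path_between G y q z" "path_between G x r z"
    by (auto simp: shortest_path_def)
  note side = side_within_distance[OF ctd w]
  show "within_distance G (real k) (set p) (set q \<union> set r) \<and>
    within_distance G (real k) (set q) (set p \<union> set r) \<and>
    within_distance G (real k) (set r) (set p \<union> set q)"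
    using side[OF s(1) p(3,2)] side[OF s(2) path_rev[OF p(1)] path_rev[OF p(3)]]
      side[OF s(3) p(1) path_rev[OF p(2)]] by (simp add: Un_commute)
qed

section \<open>Lower bounds on distances from 1-Lipschitz functions\<close>

text \<open>Each edge raises \<phi> by at most 1. An explicit \<phi> thus certifies lower bounds on
  distances in the ladder without a survey of its paths.\<close>

lemma potential_le_path_length:
  fixes \<phi> :: "'a \<Rightarrow> int"
  assumes "\<And>u v. {u, v} \<in> edges G \<Longrightarrow> \<bar>\<phi> u - \<phi> v\<bar> \<le> 1" and "path_between G x p y"
  shows "\<phi> y - \<phi> x \<le> int (path_length p)"
  using assms(2)
proof (induction p arbitrary: x)
  case Nil
  then show ?case by (simp add: path_between_def is_path_def)
next
  case (Cons a p)
  then have [simp]: "a = x" by (simp add: path_between_def)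
  show ?case
  proof (cases "p = []")
    case True
    with Cons.prems show ?thesis by (simp add: path_between_def)
  next
    case False
    with Cons.prems have "{x, hd p} \<in> edges G" "path_between G (hd p) p y"
      by (auto simp: path_between_def is_path_Cons)
    with Cons.IH[of "hd p"] assms(1)[of x "hd p"] False show ?thesis
      by (cases p) (auto simp: path_length_def)
  qed
qed

lemma potential_le_gdist:
  fixes \<phi> :: "'a \<Rightarrow> int"
  assumes "\<And>u v. {u, v} \<in> edges G \<Longrightarrow> \<bar>\<phi> u - \<phi> v\<bar> \<le> 1" and "int k \<le> \<phi> y - \<phi> x"
  shows "enat k \<le> gdist G x y"
  unfolding gdist_def
proof (rule INF_greatest)
  fix p assume "p \<in> {p. path_between G x p y}"
  then have "\<phi> y - \<phi> x \<le> int (path_length p)"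
    using potential_le_path_length[where \<phi> = \<phi>, OF assms(1)] by blast
  with assms(2) show "enat k \<le> enat (path_length p)" by simp
qed

lemma shortest_pathI_potential:
  fixes \<phi> :: "'a \<Rightarrow> int"
  assumes "\<And>u v. {u, v} \<in> edges G \<Longrightarrow> \<bar>\<phi> u - \<phi> v\<bar> \<le> 1" and "path_between G x p y"
    and "int (path_length p) \<le> \<phi> y - \<phi> x"
  shows "shortest_path G x p y"
  unfolding shortest_path_def
proof (intro conjI allI impI assms(2))
  fix q assume "path_between G x q y"
  from potential_le_path_length[where \<phi> = \<phi>, OF assms(1) this] assms(3)
  show "path_length p \<le> path_length q" by linarith
qed

section \<open>Isomorphic copies\<close>

lemma path_between_map:
  assumes "inj_on f (verts G)" "path_between G x p y"
  shows "path_between (map_graph f G) (f x) (map f p) (f y)"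
proof -
  have "is_path G p" "hd p = x" "last p = y" "p \<noteq> []"
    using assms(2) by (auto simp: path_between_def is_path_def)
  with is_path_map[OF assms(1)] show ?thesis by (simp add: path_between_def hd_map last_map)
qed

lemma path_between_map_inv:
  assumes "inj_on f (verts G)" "simple_graph G" "x \<in> verts G" "y \<in> verts G"
    and "path_between (map_graph f G) (f x) q (f y)"
  shows "path_between G x (map (inv_into (verts G) f) q) y"
proof -
  have "inj_on (inv_into (verts G) f) (verts (map_graph f G))"
    by (simp add: map_graph_def inj_on_inv_into)
  from path_between_map[OF this assms(5)] show ?thesis using assms by (simp add: map_graph_inv)
qed

lemma simple_graph_map:
  assumes "inj_on f (verts G)" "simple_graph G"
  shows "simple_graph (map_graph f G)"
  unfolding simple_graph_def
proof
  fix e assume "e \<in> edges (map_graph f G)"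
  then obtain e' where e': "e' \<in> edges G" "e = f ` e'" by (auto simp: map_graph_def)
  with assms(2) obtain u v where "u \<in> verts G" "v \<in> verts G" "u \<noteq> v" "e' = {u, v}"
    unfolding simple_graph_def by blast
  with e' assms(1) show "\<exists>u v. u \<in> verts (map_graph f G) \<and> v \<in> verts (map_graph f G) \<and> u \<noteq> v \<and> e = {u, v}"
    by (intro exI[of _ "f u"] exI[of _ "f v"]) (auto simp: map_graph_def inj_on_eq_iff)
qed

text \<open>Meant for the contrapositive: a copy of the ladder is not hyperbolic either. Shortest
  paths are carried to the copy, and distance bounds are carried back.\<close>

lemma hyperbolic_map:
  assumes inj: "inj_on f (verts G)" and G: "simple_graph G" and hyp: "hyperbolic d (map_graph f G)"
  shows "hyperbolic d G"
  unfolding hyperbolic_def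
proof (intro allI impI)
  let ?G = "map_graph f G"
  fix x y z p q r assume "shortest_path G x p y \<and> shortest_path G y q z \<and> shortest_path G x r z"
  then have s: "shortest_path G x p y" "shortest_path G y q z" "shortest_path G x r z" by auto
  have sub: "set p \<subseteq> verts G" if "shortest_path G x p y" for x p y
    using that by (auto simp: shortest_path_def path_between_def is_path_def)
  have image: "shortest_path ?G (f x) (map f p) (f y)" if p: "shortest_path G x p y" for x p y
    unfolding shortest_path_def
  proof (intro conjI allI impI)
    have p': "path_between G x p y" using p by (simp add: shortest_path_def)
    then have xy: "x \<in> verts G" "y \<in> verts G" using sub[OF p] path_between_ends by fastforce+
    show "path_between ?G (f x) (map f p) (f y)" by (rule path_between_map[OF inj p'])
    fix q assume "path_between ?G (f x) q (f y)"
    from path_between_map_inv[OF inj G xy this] p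
    show "path_length (map f p) \<le> path_length q" by (fastforce simp: shortest_path_def path_length_def)
  qed
  have le: "gdist G u v \<le> gdist ?G (f u) (f v)" if uv: "u \<in> verts G" "v \<in> verts G" for u v
    unfolding gdist_def[of ?G]
  proof (rule INF_greatest, clarify)
    fix q assume "path_between ?G (f u) q (f v)"
    from gdist_le[OF path_between_map_inv[OF inj G uv this]]
    show "gdist G u v \<le> enat (path_length q)" by (simp add: path_length_def)
  qed
  have within: "within_distance G d A B"
    if "within_distance ?G d (f ` A) (f ` B)" "A \<subseteq> verts G" "B \<subseteq> verts G" for A B
    unfolding within_distance_def
  proof
    fix v assume v: "v \<in> A"
    with that(1) obtain w where w: "w \<in> B" "ereal_of_enat (gdist ?G (f v) (f w)) \<le> ereal d"
      unfolding within_distance_def by blast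
    have "ereal_of_enat (gdist G v w) \<le> ereal_of_enat (gdist ?G (f v) (f w))"
      using le[of v w] v w that by (auto simp: subset_iff)
    with w show "\<exists>w\<in>B. ereal_of_enat (gdist G v w) \<le> ereal d" by (meson order_trans)
  qed
  have "within_distance ?G d (set (map f p)) (set (map f q) \<union> set (map f r)) \<and>
    within_distance ?G d (set (map f q)) (set (map f p) \<union> set (map f r)) \<and>
    within_distance ?G d (set (map f r)) (set (map f p) \<union> set (map f q))"
    using hyp image[OF s(1)] image[OF s(2)] image[OF s(3)] unfolding hyperbolic_def by blast
  then show "within_distance G d (set p) (set q \<union> set r) \<and> within_distance G d (set q) (set p \<union> set r) \<and>
    within_distance G d (set r) (set p \<union> set q)"
    using sub[OF s(1)] sub[OF s(2)] sub[OF s(3)] by (auto simp: image_Un intro!: within)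
qed

lemma connected_graph_map:
  assumes "inj_on f (verts G)" "connected_graph G"
  shows "connected_graph (map_graph f G)"
  unfolding connected_graph_def
proof (intro conjI ballI)
  show "verts (map_graph f G) \<noteq> {}" using assms by (simp add: map_graph_def connected_graph_def)
  fix x y assume "x \<in> verts (map_graph f G)" "y \<in> verts (map_graph f G)"
  then obtain u v where uv: "x = f u" "y = f v" "u \<in> verts G" "v \<in> verts G" by (auto simp: map_graph_def)
  with assms obtain p where "path_between G u p v" unfolding connected_graph_def by blast
  from path_between_map[OF assms(1) this] uv show "\<exists>p. path_between (map_graph f G) x p y" by blast
qed

lemma induced_subgraph_map:
  assumes "inj_on f (verts G)" "simple_graph G" "U \<subseteq> verts G"
  shows "induced_subgraph (map_graph f G) (f ` U) = map_graph f (induced_subgraph G U)"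
proof -
  have "f ` e \<subseteq> f ` U \<longleftrightarrow> e \<subseteq> U" if "e \<in> edges G" for e
  proof -
    have "e \<subseteq> verts G" using assms(2) that unfolding simple_graph_def by fastforce
    with assms(1,3) show ?thesis unfolding inj_on_def by blast
  qed
  then have "{e \<in> (`) f ` edges G. e \<subseteq> f ` U} = (`) f ` {e \<in> edges G. e \<subseteq> U}" by blast
  moreover have "f ` verts G \<inter> f ` U = f ` (verts G \<inter> U)" using assms(3) by blast
  ultimately show ?thesis by (simp add: induced_subgraph_def map_graph_def)
qed

text \<open>This renames the vertices of the graph, whereas
  \<open>connected_tree_decomposition_map\<close> renames the nodes of the tree. For (T3),
  injectivity makes the image of an intersection the intersection of the images.\<close>

lemma connected_tree_decomposition_map_graph:
  assumes inj: "inj_on f (verts G)" and G: "simple_graph G" and ctd: "connected_tree_decomposition G T V"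
  shows "connected_tree_decomposition (map_graph f G) T (\<lambda>t. f ` V t)"
proof -
  note td = connected_tree_decompositionD[OF ctd]
  show ?thesis
  proof (rule connected_tree_decompositionI)
    fix e assume "e \<in> edges (map_graph f G)"
    with td(4) show "\<exists>t\<in>verts T. e \<subseteq> f ` V t" by (force simp: map_graph_def)
  next
    fix t1 t2 t3 p assume p: "path_between T t1 p t3" "t2 \<in> set p"
    then have t: "t1 \<in> verts T" "t3 \<in> verts T"
      using path_between_ends[OF p(1)] by (auto simp: path_between_def is_path_def)
    have "f ` V t1 \<inter> f ` V t3 = f ` (V t1 \<inter> V t3)"
      using inj td(2) t by (intro inj_on_image_Int[symmetric]) auto
    with td(5) p show "f ` V t1 \<inter> f ` V t3 \<subseteq> f ` V t2" by (metis image_mono)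
  next
    fix t assume t: "t \<in> verts T"
    then have "inj_on f (verts (induced_subgraph G (V t)))"
      using inj by (auto simp: induced_subgraph_def intro: inj_on_subset)
    with t td(2,6) show "connected_graph (induced_subgraph (map_graph f G) (f ` V t))"
      by (subst induced_subgraph_map[OF inj G]) (auto intro: connected_graph_map)
  qed (use td(1,2,3) in \<open>auto simp: map_graph_def\<close>)
qed

text \<open>The parts of the ladder are vertex sets of paths, which is how they are shown to be
  connected.\<close>

lemma connected_graph_path:
  assumes "is_path G p"
  shows "connected_graph (induced_subgraph G (set p))"
  unfolding connected_graph_def
proof (intro conjI ballI)
  have v: "verts (induced_subgraph G (set p)) = set p" "p \<noteq> []"
    using assms by (auto simp: is_path_def induced_subgraph_def)
  then show "verts (induced_subgraph G (set p)) \<noteq> {}" by simp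
  have p: "is_path (induced_subgraph G (set p)) p" using assms by (simp add: is_path_induced)
  have from_hd: "\<exists>q. path_between (induced_subgraph G (set p)) (hd p) q x" if "x \<in> set p" for x
    using that is_path_segment[OF p, of 0] v(2) by (metis hd_conv_nth in_set_conv_nth le0)
  fix x y assume "x \<in> verts (induced_subgraph G (set p))" "y \<in> verts (induced_subgraph G (set p))"
  then show "\<exists>q. path_between (induced_subgraph G (set p)) x q y"
    unfolding v by (metis from_hd path_rev path_trans)
qed

section \<open>The integer line\<close>

text \<open>The decomposition tree of the ladder. It is infinite in both directions like the ladder
  itself, so there are no ends to treat separately.\<close>

definition int_line :: "int graph" where
  "int_line = \<lparr>verts = UNIV, edges = {{i, i + 1} | i. True}\<rparr>"

lemma int_line_edge: "{i, j} \<in> edges int_line \<longleftrightarrow> j = i + 1 \<or> i = j + 1"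
proof -
  have "{i, j} \<in> edges int_line \<longleftrightarrow> (\<exists>k. {i, j} = {k, k + 1})" by (simp add: int_line_def)
  then show ?thesis unfolding doubleton_eq_iff by blast
qed

lemma is_path_map_upto:
  assumes "i \<le> j" "inj f" "\<And>h. i \<le> h \<Longrightarrow> h \<le> j \<Longrightarrow> f h \<in> verts G"
    and "\<And>h. i \<le> h \<Longrightarrow> h < j \<Longrightarrow> {f h, f (h + 1)} \<in> edges G"
  shows "path_between G (f i) (map f [i..j]) (f j)"
proof -
  have "successively (\<lambda>u v. {u, v} \<in> edges G) (map f [i..j])"
    unfolding successively_conv_nth
  proof (intro allI impI)
    fix n assume "Suc n < length (map f [i..j])"
    then have "i + int n < j" by simp
    then show "{map f [i..j] ! n, map f [i..j] ! Suc n} \<in> edges G"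
      using assms(4)[of "i + int n"] by (simp add: nth_upto ac_simps)
  qed
  moreover have "hd [i..j] = i" "last [i..j] = j" using assms(1) by (simp_all add: hd_conv_nth last_conv_nth nth_upto)
  moreover have "distinct (map f [i..j])" using assms(2) by (simp add: distinct_map inj_on_def)
  ultimately show ?thesis
    using assms(1,3) by (auto simp: path_between_def is_path_def hd_map last_map)
qed

text \<open>A path on the line cannot turn back without repeating a vertex, so its direction
  \<open>s\<close> is constant.\<close>

lemma int_line_path:
  assumes "is_path int_line p"
  obtains s where "s = 1 \<or> s = -1" "\<And>i. i < length p \<Longrightarrow> p ! i = hd p + s * int i"
proof -
  have "\<exists>s. (s = 1 \<or> s = -1) \<and> (\<forall>i<length p. p ! i = hd p + s * int i)"
    using assms
  proof (induction p)
    case Nil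
    then show ?case by (simp add: is_path_def)
  next
    case (Cons a p)
    show ?case
    proof (cases "p = []")
      case True
      then show ?thesis by (intro exI[of _ 1]) auto
    next
      case False
      with Cons obtain s where s: "s = 1 \<or> s = -1" "\<forall>i<length p. p ! i = hd p + s * int i"
        by (auto simp: is_path_Cons)
      obtain s' where s': "s' = 1 \<or> s' = -1" "hd p = a + s'"
        using Cons.prems False unfolding is_path_Cons int_line_edge by force
      \<comment> \<open>A single vertex fixes no direction. Otherwise opposite signs would make the
        second vertex of \<open>p\<close> equal to \<open>a\<close>.\<close>
      have "length p = 1 \<or> s = s'"
      proof (rule ccontr)
        assume "\<not> (length p = 1 \<or> s = s')"
        with False s s' have "1 < length p" "p ! 1 = a" by (cases p; force)+
        then have "a \<in> set p" using nth_mem by metis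
        with Cons.prems show False by (simp add: is_path_Cons)
      qed
      then have "\<forall>i<length (a # p). (a # p) ! i = a + s' * int i"
        using s s' False by (auto simp: nth_Cons algebra_simps hd_conv_nth split: nat.split)
      with s' show ?thesis by auto
    qed
  qed
  with that show ?thesis by blast
qed

lemma tree_int_line: "tree int_line"
proof -
  have "\<not> is_cycle int_line c" for c
  proof
    assume c: "is_cycle int_line c"
    then have "is_path int_line c" by (simp add: is_cycle_def)
    then obtain s where s: "s = 1 \<or> s = -1" "\<And>i. i < length c \<Longrightarrow> c ! i = hd c + s * int i"
      by (rule int_line_path) blast
    \<comment> \<open>With at least three vertices, the ends of the path differ by at least 2, so no
      edge closes it.\<close>
    have "last c = hd c + s * int (length c - 1)"
    proof -
      have "c \<noteq> []" using c by (auto simp: is_cycle_def)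
      then show ?thesis using s(2)[of "length c - 1"] by (simp add: last_conv_nth)
    qed
    with c s(1) show False by (auto simp: is_cycle_def int_line_edge)
  qed
  moreover have "simple_graph int_line"
    unfolding simple_graph_def
  proof
    fix e assume "e \<in> edges int_line"
    then obtain i where "e = {i, i + 1}" by (auto simp: int_line_def)
    then show "\<exists>u v. u \<in> verts int_line \<and> v \<in> verts int_line \<and> u \<noteq> v \<and> e = {u, v}"
      by (intro exI[of _ i] exI[of _ "i + 1"]) (simp add: int_line_def)
  qed
  moreover have "\<exists>p. path_between int_line x p y" for x y
  proof -
    have up: "\<exists>p. path_between int_line x p y" if "x \<le> y" for x y
      using is_path_map_upto[of x y "\<lambda>i. i" int_line] that by (auto simp: int_line_def)
    then show ?thesis using up[of y x] path_rev by (metis linear)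
  qed
  then have "connected_graph int_line" by (auto simp: connected_graph_def int_line_def)
  ultimately show ?thesis by (simp add: tree_def forest_def)
qed

lemma int_line_between:
  assumes "path_between int_line a p b" "c \<in> set p"
  shows "min a b \<le> c \<and> c \<le> max a b"
proof -
  have p: "is_path int_line p" "hd p = a" "last p = b" using assms by (auto simp: path_between_def)
  obtain s where s: "s = 1 \<or> s = -1" "\<And>i. i < length p \<Longrightarrow> p ! i = hd p + s * int i"
    using int_line_path[OF p(1)] by blast
  from assms(2) obtain i where i: "i < length p" "p ! i = c" by (auto simp: in_set_conv_nth)
  have "p \<noteq> []" using i by auto
  then have "b = a + s * int (length p - 1)" "c = a + s * int i"
    using s(2)[of "length p - 1"] s(2)[of i] i p(2,3) by (auto simp: last_conv_nth)
  with s(1) i show ?thesis by auto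
qed

section \<open>The ladder\<close>

text \<open>Rows \<open>0\<close> and \<open>r\<close> are two-way infinite paths. The rungs join row \<open>1\<close> to row \<open>r\<close>; their upper
  ends are attached to row \<open>0\<close>, which is longer by two: \<open>(0, 1)\<close> is adjacent to \<open>(1, 0)\<close> and to
  \<open>(-1, 0)\<close>, but not to \<open>(0, 0)\<close>.\<close>

fun ladder_step :: "int \<Rightarrow> int \<times> int \<Rightarrow> int \<times> int \<Rightarrow> bool" where
  "ladder_step r (j, h) (j', h') \<longleftrightarrow>
     h = h' \<and> (h = 0 \<or> h = r) \<and> j' = j + 1 \<or>
     j = j' \<and> 1 \<le> h \<and> h' = h + 1 \<and> h' \<le> r \<or>
     h = 0 \<and> h' = 1 \<and> (0 \<le> j' \<and> j = j' + 1 \<or> j' \<le> 0 \<and> j = j' - 1)"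

lemma ladder_step_cases [consumes 1, case_names top bottom rung right left]:
  assumes "ladder_step r u v"
  obtains j where "u = (j, 0)" "v = (j + 1, 0)" | j where "u = (j, r)" "v = (j + 1, r)"
  | j h where "u = (j, h)" "v = (j, h + 1)" "1 \<le> h" "h < r"
  | j where "u = (j + 1, 0)" "v = (j, 1)" "0 \<le> j" | j where "u = (j - 1, 0)" "v = (j, 1)" "j \<le> 0"
proof -
  obtain j h j' h' where uv: "u = (j, h)" "v = (j', h')" by (cases u; cases v)
  from assms consider "h = 0" "h' = 0" "j' = j + 1" | "h = r" "h' = r" "j' = j + 1"
    | "j = j'" "1 \<le> h" "h' = h + 1" "h' \<le> r"
    | "h = 0" "h' = 1" "0 \<le> j'" "j = j' + 1" | "h = 0" "h' = 1" "j' \<le> 0" "j = j' - 1"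
    unfolding uv ladder_step.simps by metis
  then show thesis by cases (use uv in \<open>auto intro: that\<close>)
qed

definition ladder :: "int \<Rightarrow> (int \<times> int) graph" where
  "ladder r = \<lparr>verts = UNIV \<times> {0..r}, edges = {{u, v} | u v. ladder_step r u v}\<rparr>"

lemma verts_ladder: "verts (ladder r) = UNIV \<times> {0..r}"
  by (simp add: ladder_def)

lemma edges_ladder: "{u, v} \<in> edges (ladder r) \<longleftrightarrow> ladder_step r u v \<or> ladder_step r v u"
proof -
  have "{u, v} \<in> edges (ladder r) \<longleftrightarrow> (\<exists>u' v'. {u, v} = {u', v'} \<and> ladder_step r u' v')"
    by (simp add: ladder_def)
  then show ?thesis unfolding doubleton_eq_iff by blast
qed

lemma ladder_step_verts:
  assumes "ladder_step r u v" "1 \<le> r"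
  shows "u \<in> verts (ladder r)" "v \<in> verts (ladder r)" "u \<noteq> v"
  using assms by (cases rule: ladder_step_cases; simp add: verts_ladder)+

lemma simple_graph_ladder: "1 \<le> r \<Longrightarrow> simple_graph (ladder r)"
  unfolding simple_graph_def
proof
  fix e assume r: "1 \<le> r" and "e \<in> edges (ladder r)"
  then obtain u v where "e = {u, v}" "ladder_step r u v" by (auto simp: ladder_def)
  with ladder_step_verts[OF this(2) r]
  show "\<exists>u v. u \<in> verts (ladder r) \<and> v \<in> verts (ladder r) \<and> u \<noteq> v \<and> e = {u, v}" by blast
qed

text \<open>The mirror symmetry of the ladder; it leaves only the right half to be treated.\<close>

definition reflect :: "int \<times> int \<Rightarrow> int \<times> int" where
  "reflect = (\<lambda>(j, h). (- j, h))"

lemma reflect_simps [simp]: "reflect (j, h) = (- j, h)" "reflect (reflect w) = w"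
  by (cases w; simp add: reflect_def)+

lemma inj_reflect: "inj reflect"
  by (metis injI reflect_simps(2))

lemma ladder_step_reflect:
  assumes "ladder_step r u v"
  shows "ladder_step r (reflect u) (reflect v) \<or> ladder_step r (reflect v) (reflect u)"
  using assms by (cases rule: ladder_step_cases) simp_all

lemma path_between_reflect:
  assumes "path_between (ladder r) x p y"
  shows "path_between (ladder r) (reflect x) (map reflect p) (reflect y)"
proof -
  have p: "is_path (ladder r) p" "hd p = x" "last p = y" "p \<noteq> []"
    using assms by (auto simp: path_between_def is_path_def)
  have step: "{reflect u, reflect v} \<in> edges (ladder r)" if "{u, v} \<in> edges (ladder r)" for u v
    using that ladder_step_reflect unfolding edges_ladder by blast
  have "successively (\<lambda>u v. {u, v} \<in> edges (ladder r)) p" using p(1) by (simp add: is_path_def)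
  then have "successively (\<lambda>u v. {reflect u, reflect v} \<in> edges (ladder r)) p"
    by (rule successively_mono) (use step in blast)
  moreover have "distinct (map reflect p)"
    using p(1) inj_on_subset[OF inj_reflect] by (simp add: is_path_def distinct_map)
  moreover have "set (map reflect p) \<subseteq> verts (ladder r)"
  proof -
    have "reflect w \<in> verts (ladder r)" if "w \<in> verts (ladder r)" for w
      using that by (cases w) (simp add: verts_ladder)
    with p(1) show ?thesis unfolding is_path_def by auto
  qed
  ultimately show ?thesis
    using p by (simp add: path_between_def is_path_def successively_map hd_map last_map)
qed

section \<open>Paths in the ladder and its decomposition into them\<close>

lemma ladder_row0:
  assumes "i \<le> j" "1 \<le> r"
  shows "path_between (ladder r) (i, 0) (map (\<lambda>j. (j, 0)) [i..j]) (j, 0)"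
  by (rule is_path_map_upto[where f = "\<lambda>j. (j, 0)"])
    (use assms in \<open>auto simp: inj_on_def verts_ladder edges_ladder\<close>)

text \<open>The upper ends in row 0 are left out because they lie in a neighbouring column;
  \<open>column_path\<close> adds the one in column \<open>m + 1\<close>.\<close>

definition rung :: "int \<Rightarrow> int \<Rightarrow> (int \<times> int) list" where
  "rung r m = map (\<lambda>h. (m, h)) [1..r]"

lemma rung_path:
  assumes "1 \<le> r"
  shows "path_between (ladder r) (m, 1) (rung r m) (m, r)"
  unfolding rung_def
  by (rule is_path_map_upto[where f = "\<lambda>h. (m, h)"])
    (use assms in \<open>auto simp: inj_on_def verts_ladder edges_ladder\<close>)

lemma set_rung: "set (rung r m) = {m} \<times> {1..r}"
  by (auto simp: rung_def)

lemma column_path: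
  assumes "1 \<le> r" "0 \<le> m"
  shows "path_between (ladder r) (m + 1, 0) ((m + 1, 0) # rung r m) (m, r)"
proof -
  have "rung r m \<noteq> []" using assms by (simp add: rung_def)
  with rung_path[OF assms(1), of m] assms show ?thesis
    by (simp add: path_between_def is_path_Cons set_rung verts_ladder edges_ladder)
qed

text \<open>The last index of a part of the decomposition below that contains the given vertex.\<close>
fun last_bag :: "int \<Rightarrow> int \<times> int \<Rightarrow> int" where
  "last_bag r (j, h) =
     (if h = 0 then (if 1 \<le> j then 2 * j - 1 else if - 1 \<le> j then j else 2 * j + 2)
      else if j < 0 then 2 * j - 1 else if h < r then 2 * j + 1 else 2 * j + 2)"

text \<open>Reflection turns index \<open>i\<close> into \<open>- 1 - i\<close>, so the first index
  of a vertex comes from the last index of its mirror image. Each vertex occupies an interval of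
  indices, which yields (T3).\<close>

definition bag :: "int \<Rightarrow> int \<Rightarrow> (int \<times> int) set" where
  "bag r i = {w \<in> verts (ladder r). - 1 - last_bag r (reflect w) \<le> i \<and> i \<le> last_bag r w}"

lemma bag_reflect: "reflect ` bag r i = bag r (- 1 - i)"
proof -
  have "w \<in> bag r (- 1 - i) \<Longrightarrow> reflect w \<in> bag r i" for w i
    by (cases w) (auto simp: bag_def verts_ladder)
  from this[of _ i] this[of _ "- 1 - i"] show ?thesis
    by (intro equalityI subsetI) (auto simp del: reflect_simps(1), metis image_eqI reflect_simps(2))
qed

text \<open>For \<open>m\<close> at least 1, part \<open>2 * m\<close> consists of rung
  \<open>m\<close>, its upper end \<open>(m + 1, 0)\<close> and \<open>(m - 1, r)\<close>. In part
  \<open>2 * m + 1\<close> the last of these is exchanged for the next upper end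
  \<open>(m + 2, 0)\<close>. Part 0 has \<open>(0, 0)\<close> in place of
  \<open>(m - 1, r)\<close>.\<close>

lemma bag_path_nonneg:
  assumes "1 \<le> r" "0 \<le> i"
  obtains x p y where "path_between (ladder r) x p y" "set p = bag r i" "length p = nat r + 2"
proof -
  have len: "length (rung r m) = nat r" for m by (simp add: rung_def)
  define m where "m = i div 2"
  consider "i = 0" | "i = 2 * m + 1" "0 \<le> m" | "i = 2 * m" "1 \<le> m"
    using assms(2) unfolding m_def by linarith
  then show ?thesis
  proof cases
    case 1
    have "path_between (ladder r) (0, 0) ((0, 0) # (0 + 1, 0) # rung r 0) (0, r)"
      using column_path[OF assms(1), of 0] assms(1)
      by (auto simp: path_between_def is_path_Cons[of _ "(0, 0)"] set_rung verts_ladder edges_ladder)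
    moreover have "set ((0, 0) # (0 + 1, 0) # rung r 0) = bag r i"
      using 1 assms(1) by (auto simp: set_rung bag_def verts_ladder split: if_splits)
    ultimately show ?thesis by (rule that) (simp add: len)
  next
    case 2
    have "path_between (ladder r) (m + 2, 0) ((m + 2, 0) # (m + 1, 0) # rung r m) (m, r)"
      using column_path[OF assms(1) 2(2)] assms(1) 2(2)
      by (auto simp: path_between_def is_path_Cons[of _ "(m + 2, 0)"] set_rung verts_ladder edges_ladder)
    moreover have "set ((m + 2, 0) # (m + 1, 0) # rung r m) = bag r i"
      using 2 assms(1) by (auto simp: set_rung bag_def verts_ladder split: if_splits)
    ultimately show ?thesis by (rule that) (simp add: len)
  next
    case 3
    then have m: "0 \<le> m" by simp
    have "path_between (ladder r) (m + 1, 0) (((m + 1, 0) # rung r m) @ [(m - 1, r)]) (m - 1, r)"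
      using column_path[OF assms(1) m] assms(1) m
      unfolding path_between_def is_path_append
      by (auto simp: is_path_Cons[of _ _ "[]"] set_rung verts_ladder edges_ladder)
    moreover have "set (((m + 1, 0) # rung r m) @ [(m - 1, r)]) = bag r i"
      using 3 assms(1) by (auto simp: set_rung bag_def verts_ladder split: if_splits)
    ultimately show ?thesis by (rule that) (simp add: len)
  qed
qed

lemma bag_path:
  assumes "1 \<le> r"
  obtains x p y where "path_between (ladder r) x p y" "set p = bag r i" "length p = nat r + 2"
proof (cases "0 \<le> i")
  case True
  then show ?thesis using bag_path_nonneg[OF assms] that by blast
next
  case False
  then have "0 \<le> - 1 - i" by simp
  from bag_path_nonneg[OF assms this] obtain x p y where p: "path_between (ladder r) x p y"
    "set p = bag r (- 1 - i)" "length p = nat r + 2" .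
  from path_between_reflect[OF p(1)] show ?thesis
    by (rule that) (use p bag_reflect[of r "- 1 - i"] in auto)
qed

lemma ladder_decomposition:
  assumes r: "1 \<le> r"
  shows "connected_tree_decomposition (ladder r) int_line (bag r)"
    and "width int_line (bag r) \<le> enat (nat r + 1)"
proof -
  have nonempty: "- 1 - last_bag r (reflect w) \<le> last_bag r w" for w
    by (cases w) auto
  \<comment> \<open>The index intervals of adjacent vertices each start no later than the other one
    ends. Being non-empty, they intersect, and the larger left end lies in both.\<close>
  have common: "- 1 - last_bag r (reflect u) \<le> last_bag r v \<and> - 1 - last_bag r (reflect v) \<le> last_bag r u"
    if "ladder_step r u v" for u v
    using that r by (cases rule: ladder_step_cases) auto
  show "connected_tree_decomposition (ladder r) int_line (bag r)"
  proof (rule connected_tree_decompositionI)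
    fix v assume "v \<in> verts (ladder r)"
    with nonempty[of v] show "\<exists>t\<in>verts int_line. v \<in> bag r t"
      by (auto simp: int_line_def bag_def)
  next
    fix e assume "e \<in> edges (ladder r)"
    then obtain u v where e: "e = {u, v}" "ladder_step r u v" by (auto simp: ladder_def)
    let ?t = "max (- 1 - last_bag r (reflect u)) (- 1 - last_bag r (reflect v))"
    have "u \<in> bag r ?t" "v \<in> bag r ?t"
      using nonempty[of u] nonempty[of v] common[OF e(2)] ladder_step_verts[OF e(2) r]
      by (auto simp: bag_def)
    with e show "\<exists>t\<in>verts int_line. e \<subseteq> bag r t" by (auto simp: int_line_def)
  next
    fix t1 t2 t3 p assume "path_between int_line t1 p t3" "t2 \<in> set p"
    from int_line_between[OF this] show "bag r t1 \<inter> bag r t3 \<subseteq> bag r t2"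
      by (auto simp: bag_def)
  next
    fix t
    obtain x p y where "path_between (ladder r) x p y" "set p = bag r t"
      by (rule bag_path[OF r])
    with connected_graph_path[of "ladder r" p]
    show "connected_graph (induced_subgraph (ladder r) (bag r t))" by (simp add: path_between_def)
  qed (auto simp: tree_int_line bag_def)
  have "esize (bag r t) \<le> enat (nat r + 2)" for t
  proof -
    obtain x p y where p: "path_between (ladder r) x p y" "set p = bag r t" "length p = nat r + 2"
      by (rule bag_path[OF r])
    from card_length[of p] p(2,3) have "card (bag r t) \<le> nat r + 2" by simp
    moreover have "finite (bag r t)" by (metis p(2) finite_set)
    ultimately show ?thesis by (simp add: esize_def)
  qed
  then have "(SUP t\<in>verts int_line. esize (bag r t)) \<le> enat (nat r + 2)" by (rule SUP_least)
  then show "width int_line (bag r) \<le> enat (nat r + 1)"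
    unfolding width_def by (cases "SUP t\<in>verts int_line. esize (bag r t)") (auto simp: one_enat_def)
qed

section \<open>Distances in the ladder and a geodesic triangle\<close>

lemma abs_step_ladder:
  assumes "\<And>u v. ladder_step r u v \<Longrightarrow> \<bar>\<phi> u - \<phi> v\<bar> \<le> (1::int)" and "{u, v} \<in> edges (ladder r)"
  shows "\<bar>\<phi> u - \<phi> v\<bar> \<le> 1"
  using assms(1)[of u v] assms(1)[of v u] assms(2) unfolding edges_ladder by linarith

text \<open>The sides are row \<open>0\<close> from \<open>(- r - 1, 0)\<close> to \<open>(r + 1, 0)\<close>, and the paths from its ends
  along a rung and row \<open>r\<close> to \<open>(0, r)\<close>. The vertex \<open>(0, 0)\<close> has distance \<open>r + 1\<close> from the latter.\<close>
lemma ladder_not_hyperbolic: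
  assumes r: "1 \<le> r"
  shows "\<not> hyperbolic (real_of_int r) (ladder r)"
proof
  assume hyp: "hyperbolic (real_of_int r) (ladder r)"
  let ?G = "ladder r"
  define P where "P = map (\<lambda>j. (j, 0::int)) [- r - 1..r + 1]"
  define Q where "Q = ((r + 1, 0) # rung r r) @ map (\<lambda>i. (r - i, r)) [1..r]"
  have P: "path_between ?G (- r - 1, 0) P (r + 1, 0)"
    unfolding P_def by (rule ladder_row0) (use r in auto)
  have row: "path_between ?G (r - 1, r) (map (\<lambda>i. (r - i, r)) [1..r]) (r - r, r)"
    by (rule is_path_map_upto[where f = "\<lambda>i. (r - i, r)"])
      (use r in \<open>auto simp: inj_on_def verts_ladder edges_ladder\<close>)
  have Q: "path_between ?G (r + 1, 0) Q (0, r)"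
    using column_path[OF r, of r] row r unfolding Q_def path_between_def is_path_append
    by (auto simp: set_rung edges_ladder)
  have Q': "path_between ?G (- r - 1, 0) (map reflect Q) (0, r)"
    using path_between_reflect[OF Q] by simp
  have len: "path_length P = nat (2 * r + 2)" "path_length Q = nat (2 * r)" "path_length (map reflect Q) = nat (2 * r)"
    using r by (auto simp: path_length_def P_def Q_def rung_def)
  \<comment> \<open>\<open>P\<close> moves one column per edge, and no edge moves further.\<close>
  have sP: "shortest_path ?G (- r - 1, 0) P (r + 1, 0)"
    by (rule shortest_pathI_potential[where \<phi> = fst, OF abs_step_ladder P])
      (use r len in \<open>auto\<close>)
  \<comment> \<open>\<psi> rises by \<open>2 * r\<close> from either of \<open>(r + 1, 0)\<close>
    and \<open>(- r - 1, 0)\<close> to \<open>(0, r)\<close>. Row 0 counts like row 1 because the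
    edges between them already change the column.\<close>
  define \<psi> :: "int \<times> int \<Rightarrow> int" where "\<psi> = (\<lambda>(j, h). (if h = 0 then 1 else h) - \<bar>j\<bar>)"
  have \<psi>: "\<bar>\<psi> u - \<psi> v\<bar> \<le> 1" if "ladder_step r u v" for u v
    using that r by (cases rule: ladder_step_cases) (auto simp: \<psi>_def)
  have sQ: "shortest_path ?G (r + 1, 0) Q (0, r)"
    by (rule shortest_pathI_potential[where \<phi> = \<psi>, OF abs_step_ladder[OF \<psi>] Q])
      (use r len in \<open>auto simp: \<psi>_def\<close>)
  have sQ': "shortest_path ?G (- r - 1, 0) (map reflect Q) (0, r)"
    by (rule shortest_pathI_potential[where \<phi> = \<psi>, OF abs_step_ladder[OF \<psi>] Q'])
      (use r len in \<open>auto simp: \<psi>_def\<close>)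
  \<comment> \<open>\<chi> is the distance from \<open>(0, 0)\<close>. Row \<open>h > 0\<close>
    counts \<open>h + 1\<close> because the edge from row 0 to row 1 also leads one column back
    towards column 0.\<close>
  define \<chi> :: "int \<times> int \<Rightarrow> int" where "\<chi> = (\<lambda>(j, h). \<bar>j\<bar> + (if h = 0 then 0 else h + 1))"
  have \<chi>: "\<bar>\<chi> u - \<chi> v\<bar> \<le> 1" if "ladder_step r u v" for u v
    using that r by (cases rule: ladder_step_cases) (auto simp: \<chi>_def)
  have \<chi>_far: "r + 1 \<le> \<chi> w" if "w \<in> set Q \<union> set (map reflect Q)" for w
    using that r by (auto simp: Q_def set_rung \<chi>_def)
  have "\<chi> (0, 0) = 0" by (simp add: \<chi>_def)
  then have far: "enat (nat r + 1) \<le> gdist ?G (0, 0) w" if "w \<in> set Q \<union> set (map reflect Q)" for w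
    using \<chi>_far[OF that] r by (intro potential_le_gdist[where \<phi> = \<chi>, OF abs_step_ladder[OF \<chi>]]) auto
  have "(0, 0) \<in> set P" using r by (auto simp: P_def)
  then obtain w where w: "w \<in> set Q \<union> set (map reflect Q)"
    "ereal_of_enat (gdist ?G (0, 0) w) \<le> ereal (real_of_int r)"
    using hyp sP sQ sQ' unfolding hyperbolic_def within_distance_def by blast
  from far[OF w(1)] w(2) r show False by (cases "gdist ?G (0, 0) w") auto
qed

section \<open>Sharpness of the bound\<close>

lemma hyperbolic_mono:
  assumes "hyperbolic d G" "d \<le> d'"
  shows "hyperbolic d' G"
proof -
  have "within_distance G d' A B" if "within_distance G d A B" for A B
    using that assms(2) unfolding within_distance_def by (meson ereal_less_eq(3) order_trans)
  with assms(1) show ?thesis unfolding hyperbolic_def by blast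
qed

text \<open>The ladder is countable and is copied to the natural numbers by \<open>to_nat\<close>;
  \<open>connected_treewidth_le\<close> permits the integers as nodes of its decomposition.\<close>

lemma exists_not_hyperbolic:
  assumes k: "1 < k"
  shows "\<exists>G :: nat graph. simple_graph G \<and> connected_treewidth G = enat k \<and> \<not> hyperbolic (real k - 1) G"
proof -
  \<comment> \<open>The parts have \<open>r + 2\<close> vertices, giving width \<open>r + 1\<close>,
    and the triangle defeats the constant \<open>r\<close>. Both fit \<open>k\<close> when
    \<open>r = k - 1\<close>.\<close>
  define r where "r = int k - 1"
  have r: "1 \<le> r" "nat r + 1 = k" "real_of_int r = real k - 1" using k by (auto simp: r_def)
  define f :: "int \<times> int \<Rightarrow> nat" where "f = to_nat"
  have inj: "inj_on f (verts (ladder r))" unfolding f_def by (rule inj_on_subset[OF inj_to_nat]) simp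
  let ?G = "map_graph f (ladder r)"
  note L = simple_graph_ladder[OF r(1)]
  have G: "simple_graph ?G" by (rule simple_graph_map[OF inj L])
  have not_hyp: "\<not> hyperbolic (real k - 1) ?G"
    using hyperbolic_map[OF inj L] ladder_not_hyperbolic[OF r(1)] r(3) by metis
  have "width int_line (\<lambda>t. f ` bag r t) = width int_line (bag r)"
  proof -
    have "inj_on f (bag r t)" for t using inj by (rule inj_on_subset) (auto simp: bag_def)
    then show ?thesis by (simp add: width_def esize_def card_image finite_image_iff)
  qed
  then have "connected_treewidth ?G \<le> enat k"
    using connected_treewidth_le[OF G connected_tree_decomposition_map_graph[OF inj L ladder_decomposition(1)[OF r(1)]]]
      ladder_decomposition(2)[OF r(1)] r(2) by simp
  moreover have "\<not> connected_treewidth ?G < enat k"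
  proof
    \<comment> \<open>A smaller width \<open>m\<close> would make the graph
      \<open>m\<close>-hyperbolic, and as \<open>m\<close> is at most \<open>k - 1\<close>, this
      contradicts \<open>not_hyp\<close>.\<close>
    assume less: "connected_treewidth ?G < enat k"
    then obtain m where m: "connected_treewidth ?G = enat m" by (cases "connected_treewidth ?G") auto
    then obtain T :: "nat list graph" and V where "connected_tree_decomposition ?G T V" "width T V = enat m"
      by (rule connected_treewidth_attained)
    then have "hyperbolic (real m) ?G" using hyperbolic_if_width_le by fastforce
    with hyperbolic_mono[of "real m" ?G "real k - 1"] less m not_hyp show False by simp
  qed
  ultimately have "connected_treewidth ?G = enat k" by simp
  with G not_hyp show ?thesis by blast
qed

theorem theorem1p3:
  shows "(\<forall>k::nat. k > 1 \<longrightarrow>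
            (\<forall>G :: 'a graph. simple_graph G \<and> connected_treewidth G = enat k \<longrightarrow>
               hyperbolic (real k) G) \<and>
            (\<exists>G :: nat graph. simple_graph G \<and> connected_treewidth G = enat k \<and>
               \<not> hyperbolic (real k - 1) G)) \<and>
         (\<forall>G :: 'a graph. simple_graph G \<and> connected_treewidth G = enat 1 \<longrightarrow> forest G) \<and>
         (\<forall>G :: 'a graph. forest G \<longrightarrow> hyperbolic 0 G)"
proof (intro conjI allI impI)
  fix k :: nat and G :: "'a graph"
  assume "simple_graph G \<and> connected_treewidth G = enat k"
  then obtain T :: "'a list graph" and V where "connected_tree_decomposition G T V" "width T V = enat k"
    using connected_treewidth_attained by blast
  then show "hyperbolic (real k) G" by (intro hyperbolic_if_width_le[of G T V]) simp_all
next
  fix k :: nat assume "1 < k"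
  then show "\<exists>G :: nat graph. simple_graph G \<and> connected_treewidth G = enat k \<and> \<not> hyperbolic (real k - 1) G"
    by (rule exists_not_hyperbolic)
next
  fix G :: "'a graph"
  assume G: "simple_graph G \<and> connected_treewidth G = enat 1"
  then obtain T :: "'a list graph" and V where "connected_tree_decomposition G T V" "width T V = enat 1"
    using connected_treewidth_attained by blast
  with G show "forest G" by (intro forest_if_width_1[of G T V]) (auto simp: one_enat_def)
next
  fix G :: "'a graph"
  assume "forest G"
  then show "hyperbolic 0 G" by (rule forest_0_hyperbolic)
qed

end
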